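(* Schlumprecht's space $S$ is not weakly null normalized asymptotically symmetric (w.n.a.s.).
   Context: Definition of $S$: let $c_{00}$ be the space of finitely supported real sequences. For $x\in c_{00}$ and $E\subseteq\mathbb{N}$ let $Ex(i)=x(i)$ if $i\in E$ and $Ex(i)=0$ otherwise; $E<F$ means $\max E<\min F$. Let $f(k)=\log_2(k+1)$. $S$ is the completion of $c_{00}$ under the norm which satisfies the implicit equation $$\|x\|=\max\Big\{\|x\|_\infty,\ \sup\frac1{f(k)}\sum_{j=1}^k\|E_jx\|\Big\},$$ where the sup is taken over all $k\ge2$ and sets of integers $E_1<\cdots<E_k$. A Banach space $X$ is weakly null normalized asymptotically symmetric (w.n.a.s.) if there is $C<\infty$ such that for all $m\in\mathbb{N}$, all normalized weakly null sequences $(x_n^i)_{n=1}^\infty\subseteq X$, $1\le i\le m$, and all permutations $\sigma$ of $\{1,\ldots,m\}$, $$\lim_{n_1\to\infty}\cdots\lim_{n_m\to\infty}\Big\|\sum_{i=1}^m x_{n_i}^i\Big\|\le C\lim_{n_{\sigma(1)}\to\infty}\cdots\lim_{n_{\sigma(m)}\to\infty}\Big\|\sum_{i=1}^m x_{n_i}^i\Big\|,$$ provided that these iterated limits exist. *)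

theory Defs
  imports "HOL-Analysis.Analysis"
begin

section \<open>The completion of a normed space\<close>

definition cauchy_equiv :: "(nat \<Rightarrow> 'a::real_normed_vector) \<Rightarrow> (nat \<Rightarrow> 'a) \<Rightarrow> bool" where
  "cauchy_equiv X Y \<longleftrightarrow> Cauchy X \<and> Cauchy Y \<and> (\<lambda>n. X n - Y n) \<longlonglongrightarrow> 0"

lemma cauchy_equiv_refl: "Cauchy X \<Longrightarrow> cauchy_equiv X X"
  by (simp add: cauchy_equiv_def)

lemma part_equivp_cauchy_equiv:
  "part_equivp (cauchy_equiv :: (nat \<Rightarrow> 'a::real_normed_vector) \<Rightarrow> (nat \<Rightarrow> 'a) \<Rightarrow> bool)"
proof (rule part_equivpI)
  show "\<exists>X. cauchy_equiv X (X :: nat \<Rightarrow> 'a)"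
    by (rule exI[of _ "\<lambda>_. 0"]) (simp add: cauchy_equiv_def Cauchy_def)
  show "symp (cauchy_equiv :: (nat \<Rightarrow> 'a) \<Rightarrow> _)"
  proof (rule sympI)
    fix X Y :: "nat \<Rightarrow> 'a" assume "cauchy_equiv X Y"
    then show "cauchy_equiv Y X"
      using tendsto_minus[of "\<lambda>n. X n - Y n" 0 sequentially] by (simp add: cauchy_equiv_def)
  qed
  show "transp (cauchy_equiv :: (nat \<Rightarrow> 'a) \<Rightarrow> _)"
  proof (rule transpI)
    fix X Y Z :: "nat \<Rightarrow> 'a" assume "cauchy_equiv X Y" "cauchy_equiv Y Z"
    then show "cauchy_equiv X Z"
      using tendsto_add[of "\<lambda>n. X n - Y n" 0 sequentially "\<lambda>n. Y n - Z n" 0]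
      by (simp add: cauchy_equiv_def)
  qed
qed

quotient_type (overloaded) 'a completion =
  "nat \<Rightarrow> 'a::real_normed_vector" / partial: cauchy_equiv
  by (rule part_equivp_cauchy_equiv)

lemma Cauchy_plus':
  fixes X Y :: "nat \<Rightarrow> 'a::real_normed_vector"
  assumes "Cauchy X" "Cauchy Y" shows "Cauchy (\<lambda>n. X n + Y n)"
proof (rule CauchyI)
  fix e :: real assume "0 < e"
  then obtain K M where K: "\<forall>m\<ge>K. \<forall>n\<ge>K. norm (X m - X n) < e / 2"
    and M: "\<forall>m\<ge>M. \<forall>n\<ge>M. norm (Y m - Y n) < e / 2"
    using CauchyD[OF assms(1), of "e / 2"] CauchyD[OF assms(2), of "e / 2"] by auto
  have "norm ((X m + Y m) - (X n + Y n)) < e" if "m \<ge> max K M" "n \<ge> max K M" for m n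
    using K[rule_format, of m n] M[rule_format, of m n] that
      norm_triangle_ineq[of "X m - X n" "Y m - Y n"] by (simp add: add_diff_add)
  then show "\<exists>M. \<forall>m\<ge>M. \<forall>n\<ge>M. norm ((X m + Y m) - (X n + Y n)) < e" by blast
qed

lemma Cauchy_scaleR':
  fixes X :: "nat \<Rightarrow> 'a::real_normed_vector"
  shows "Cauchy X \<Longrightarrow> Cauchy (\<lambda>n. a *\<^sub>R X n)"
  by (rule bounded_linear.Cauchy[OF bounded_linear_scaleR_right])

lemma Cauchy_norm':
  fixes X :: "nat \<Rightarrow> 'a::real_normed_vector"
  assumes "Cauchy X" shows "Cauchy (\<lambda>n. norm (X n))"
proof (rule CauchyI)
  fix e :: real assume "0 < e"
  then obtain M where M: "\<forall>m\<ge>M. \<forall>n\<ge>M. norm (X m - X n) < e"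
    using CauchyD[OF assms] by blast
  then show "\<exists>M. \<forall>m\<ge>M. \<forall>n\<ge>M. norm (norm (X m) - norm (X n)) < e"
    by (intro exI[of _ M]) (auto intro: le_less_trans[OF norm_triangle_ineq3])
qed

lemma norm_lim:
  fixes X :: "nat \<Rightarrow> 'a::real_normed_vector"
  assumes "Cauchy X" shows "(\<lambda>n. norm (X n)) \<longlonglongrightarrow> lim (\<lambda>n. norm (X n))"
  using Cauchy_norm'[OF assms] real_Cauchy_convergent convergent_LIMSEQ_iff by blast

instantiation completion :: (real_normed_vector) real_vector
begin

lift_definition zero_completion :: "'a completion" is "\<lambda>_. 0"
  by (simp add: cauchy_equiv_def Cauchy_def)

lift_definition plus_completion :: "'a completion \<Rightarrow> 'a completion \<Rightarrow> 'a completion"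
  is "\<lambda>X Y n. X n + Y n"
proof -
  fix X X' Y Y' :: "nat \<Rightarrow> 'a" assume "cauchy_equiv X X'" "cauchy_equiv Y Y'"
  then show "cauchy_equiv (\<lambda>n. X n + Y n) (\<lambda>n. X' n + Y' n)"
    using tendsto_add[of "\<lambda>n. X n - X' n" 0 sequentially "\<lambda>n. Y n - Y' n" 0]
    by (auto simp: cauchy_equiv_def Cauchy_plus' algebra_simps)
qed

lift_definition scaleR_completion :: "real \<Rightarrow> 'a completion \<Rightarrow> 'a completion"
  is "\<lambda>a X n. a *\<^sub>R X n"
proof -
  fix a :: real and X X' :: "nat \<Rightarrow> 'a" assume "cauchy_equiv X X'"
  then show "cauchy_equiv (\<lambda>n. a *\<^sub>R X n) (\<lambda>n. a *\<^sub>R X' n)"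
    using tendsto_scaleR[of "\<lambda>_. a" a sequentially "\<lambda>n. X n - X' n" 0]
    by (auto simp: cauchy_equiv_def Cauchy_scaleR' algebra_simps)
qed

definition uminus_completion :: "'a completion \<Rightarrow> 'a completion" where
  "uminus_completion x = (-1) *\<^sub>R x"

definition minus_completion :: "'a completion \<Rightarrow> 'a completion \<Rightarrow> 'a completion" where
  "minus_completion x y = x + (-1) *\<^sub>R y"

instance
proof
  fix x y z :: "'a completion" and a b :: real
  show "x + y + z = x + (y + z)"
    by transfer (auto simp: cauchy_equiv_def algebra_simps intro!: Cauchy_plus')
  show "x + y = y + x"
    by transfer (auto simp: cauchy_equiv_def algebra_simps intro!: Cauchy_plus')
  show "0 + x = x"
    by transfer (auto simp: cauchy_equiv_def)
  show "- x + x = 0" unfolding uminus_completion_def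
    by transfer (auto simp: cauchy_equiv_def Cauchy_def)
  show "x - y = x + - y"
    by (simp add: uminus_completion_def minus_completion_def)
  show "a *\<^sub>R (x + y) = a *\<^sub>R x + a *\<^sub>R y"
    by transfer (auto simp: cauchy_equiv_def algebra_simps
        simp flip: scaleR_add_right intro!: Cauchy_plus' Cauchy_scaleR')
  show "(a + b) *\<^sub>R x = a *\<^sub>R x + b *\<^sub>R x"
    by transfer (auto simp: cauchy_equiv_def scaleR_left_distrib
        intro!: Cauchy_plus' Cauchy_scaleR')
  show "a *\<^sub>R b *\<^sub>R x = (a * b) *\<^sub>R x"
    by transfer (auto simp: cauchy_equiv_def intro!: Cauchy_scaleR')
  show "1 *\<^sub>R x = x"
    by transfer (auto simp: cauchy_equiv_def)
qed

end

lift_definition of_completion :: "'a::real_normed_vector \<Rightarrow> 'a completion" is "\<lambda>x _. x"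
  by (simp add: cauchy_equiv_def Cauchy_def)

instantiation completion :: (real_normed_vector) real_normed_vector
begin

lift_definition norm_completion :: "'a completion \<Rightarrow> real" is "\<lambda>X. lim (\<lambda>n. norm (X n))"
proof -
  fix X Y :: "nat \<Rightarrow> 'a" assume XY: "cauchy_equiv X Y"
  have "(\<lambda>n. norm (X n - Y n)) \<longlonglongrightarrow> 0"
    using XY by (simp add: cauchy_equiv_def tendsto_norm_zero)
  then have "(\<lambda>n. norm (X n) - norm (Y n)) \<longlonglongrightarrow> 0"
    by (rule Lim_null_comparison[rotated])
      (auto intro!: always_eventually simp: norm_triangle_ineq3)
  moreover have "(\<lambda>n. norm (X n) - norm (Y n)) \<longlonglongrightarrow> lim (\<lambda>n. norm (X n)) - lim (\<lambda>n. norm (Y n))"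
    using XY by (intro tendsto_diff norm_lim) (auto simp: cauchy_equiv_def)
  ultimately show "lim (\<lambda>n. norm (X n)) = lim (\<lambda>n. norm (Y n))"
    using LIMSEQ_unique by fastforce
qed

definition dist_completion :: "'a completion \<Rightarrow> 'a completion \<Rightarrow> real" where
  "dist_completion x y = norm (x - y)"

definition sgn_completion :: "'a completion \<Rightarrow> 'a completion" where
  "sgn_completion x = x /\<^sub>R norm x"

definition uniformity_completion :: "('a completion \<times> 'a completion) filter" where
  "uniformity_completion = (INF e\<in>{0 <..}. principal {(x, y). dist x y < e})"

definition open_completion :: "'a completion set \<Rightarrow> bool" where
  "open_completion S = (\<forall>x\<in>S. \<forall>\<^sub>F (x', y) in uniformity. x' = x \<longrightarrow> y \<in> S)"

instance
proof
  fix x y :: "'a completion" and a :: real and S :: "'a completion set"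
  show "dist x y = norm (x - y)" by (rule dist_completion_def)
  show "sgn x = x /\<^sub>R norm x" by (rule sgn_completion_def)
  show "(uniformity :: ('a completion \<times> 'a completion) filter)
      = (INF e\<in>{0 <..}. principal {(x, y). dist x y < e})"
    by (rule uniformity_completion_def)
  show "open S = (\<forall>x\<in>S. \<forall>\<^sub>F (x', y) in uniformity. x' = x \<longrightarrow> y \<in> S)"
    by (rule open_completion_def)
  show "norm x = 0 \<longleftrightarrow> x = 0"
  proof (transfer, unfold cauchy_equiv_def, safe)
    fix X :: "nat \<Rightarrow> 'a" assume X: "Cauchy X"
    show "Cauchy (\<lambda>_. 0 :: 'a)" by (simp add: Cauchy_def)
    {
      assume "lim (\<lambda>n. norm (X n)) = 0"
      then show "(\<lambda>n. X n - 0) \<longlonglongrightarrow> 0"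
        using norm_lim[OF X] tendsto_norm_zero_iff by auto
    }
    {
      assume "(\<lambda>n. X n - 0) \<longlonglongrightarrow> 0"
      then show "lim (\<lambda>n. norm (X n)) = 0"
        using limI tendsto_norm_zero by fastforce
    }
  qed
  show "norm (x + y) \<le> norm x + norm y"
  proof (transfer, unfold cauchy_equiv_def, safe)
    fix X Y :: "nat \<Rightarrow> 'a" assume X: "Cauchy X" and Y: "Cauchy Y"
    show "lim (\<lambda>n. norm (X n + Y n)) \<le> lim (\<lambda>n. norm (X n)) + lim (\<lambda>n. norm (Y n))"
      by (rule tendsto_le[OF _ tendsto_add[OF norm_lim[OF X] norm_lim[OF Y]]
            norm_lim[OF Cauchy_plus'[OF X Y]]])
        (auto intro!: always_eventually simp: norm_triangle_ineq)
  qed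
  show "norm (a *\<^sub>R x) = \<bar>a\<bar> * norm x"
  proof (transfer, unfold cauchy_equiv_def, safe)
    fix a :: real and X :: "nat \<Rightarrow> 'a" assume X: "Cauchy X"
    show "lim (\<lambda>n. norm (a *\<^sub>R X n)) = \<bar>a\<bar> * lim (\<lambda>n. norm (X n))"
      unfolding norm_scaleR by (rule limI[OF tendsto_mult_left[OF norm_lim[OF X]]])
  qed
qed

end

lemma linear_of_completion: "linear (of_completion :: 'a::real_normed_vector \<Rightarrow> _)"
proof (rule linearI)
  fix x y :: 'a and a :: real
  show "of_completion (x + y) = of_completion x + of_completion y"
    by transfer (simp add: cauchy_equiv_def Cauchy_def)
  show "of_completion (a *\<^sub>R x) = a *\<^sub>R of_completion x"
    by transfer (simp add: cauchy_equiv_def Cauchy_def)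
qed

lemma norm_of_completion: "norm (of_completion x) = norm x"
  by transfer (simp add: limI)

lemma of_completion_tendsto:
  assumes "Cauchy X"
  shows "(\<lambda>n. of_completion (X n)) \<longlonglongrightarrow> abs_completion X"
proof (rule LIMSEQ_I)
  fix e :: real assume e: "0 < e"
  then obtain M where M: "\<forall>m\<ge>M. \<forall>n\<ge>M. norm (X m - X n) < e / 2"
    using CauchyD[OF assms, of "e / 2"] by auto
  have X: "cauchy_equiv X X" using assms by (rule cauchy_equiv_refl)
  have "norm (of_completion (X n) - abs_completion X) < e" if n: "n \<ge> M" for n
  proof -
    have c: "cauchy_equiv (\<lambda>_. X n) (\<lambda>_. X n)"
      by (simp add: cauchy_equiv_def Cauchy_def)
    have C: "Cauchy (\<lambda>m. X n + (-1) *\<^sub>R X m)"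
      using Cauchy_plus'[OF _ Cauchy_scaleR'[OF assms, of "-1"], of "\<lambda>_. X n"]
      by (simp add: Cauchy_def)
    have "of_completion (X n) - abs_completion X = abs_completion (\<lambda>m. X n + (-1) *\<^sub>R X m)"
      unfolding minus_completion_def of_completion.abs_eq
        scaleR_completion.abs_eq[OF X]
      by (rule plus_completion.abs_eq)
        (use c X in \<open>auto simp: cauchy_equiv_def intro: Cauchy_scaleR'[of _ "-1", simplified]\<close>)
    then have "norm (of_completion (X n) - abs_completion X) = lim (\<lambda>m. norm (X n + (-1) *\<^sub>R X m))"
      using norm_completion.abs_eq[OF cauchy_equiv_refl[OF C]] by simp
    also have "\<dots> \<le> e / 2"
      by (rule LIMSEQ_le_const2[OF norm_lim[OF C]])
        (use M n in \<open>auto intro!: exI[of _ M] less_imp_le\<close>)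
    finally show ?thesis using e by simp
  qed
  then show "\<exists>M. \<forall>n\<ge>M. norm (of_completion (X n) - abs_completion X) < e" by blast
qed

lemma closure_range_of_completion:
  "closure (range (of_completion :: 'a::real_normed_vector \<Rightarrow> _)) = UNIV"
proof -
  have "x \<in> closure (range (of_completion :: 'a \<Rightarrow> _))" for x :: "'a completion"
  proof (induction x rule: completion.abs_induct)
    case (1 X)
    then have "(\<lambda>n. of_completion (X n)) \<longlonglongrightarrow> abs_completion X"
      by (auto simp: cauchy_equiv_def intro: of_completion_tendsto)
    then show ?case unfolding closure_sequential
      by (intro exI[of _ "\<lambda>n. of_completion (X n)"]) simp
  qed
  then show ?thesis by blast
qed

instance completion :: (real_normed_vector) banach
proof
  fix Y :: "nat \<Rightarrow> 'a completion" assume Y: "Cauchy Y"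
  have "\<exists>a. dist (of_completion a) (Y n) < 1 / real (Suc n)" for n
  proof -
    have "Y n \<in> closure (range of_completion)" by (simp add: closure_range_of_completion)
    then have "\<exists>y\<in>range of_completion. dist y (Y n) < 1 / real (Suc n)"
      unfolding closure_approachable by (meson of_nat_0_less_iff zero_less_Suc zero_less_divide_1_iff)
    then show ?thesis by auto
  qed
  then obtain a where a: "\<And>n. dist (of_completion (a n)) (Y n) < 1 / real (Suc n)" by metis
  have d: "(\<lambda>n. of_completion (a n) - Y n) \<longlonglongrightarrow> 0"
  proof (rule Lim_null_comparison)
    show "(\<lambda>n. 1 / real (Suc n)) \<longlonglongrightarrow> 0" using LIMSEQ_inverse_real_of_nat by (simp add: inverse_eq_divide)
    show "\<forall>\<^sub>F n in sequentially. norm (of_completion (a n) - Y n) \<le> 1 / real (Suc n)"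
      using a by (auto intro!: always_eventually less_imp_le simp: dist_norm)
  qed
  then have "Cauchy (\<lambda>n. (of_completion (a n) - Y n) + Y n)"
    by (intro Cauchy_plus' Y) (rule LIMSEQ_imp_Cauchy)
  then have "Cauchy (\<lambda>n. of_completion (a n))" by simp
  moreover have "norm (of_completion (x :: 'a) - of_completion y) = norm (x - y)" for x y
    using linear_diff[OF linear_of_completion, of x y] norm_of_completion by metis
  ultimately have "Cauchy a" by (simp add: Cauchy_def dist_norm)
  then have "(\<lambda>n. of_completion (a n) - (of_completion (a n) - Y n)) \<longlonglongrightarrow> abs_completion a - 0"
    by (intro tendsto_diff d of_completion_tendsto)
  then show "convergent Y" by (auto simp: convergent_def)
qed

section \<open>Schlumprecht's norm on \<open>c\<^sub>0\<^sub>0\<close>\<close>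

typedef c00 = "{x :: nat \<Rightarrow> real. finite {i. x i \<noteq> 0}}"
  morphisms coord Abs_c00
  by (rule exI[of _ "\<lambda>_. 0"]) simp

setup_lifting type_definition_c00

lemma finite_coord [simp]: "finite {i. coord x i \<noteq> 0}"
  using coord[of x] by simp

lemma c00_eqI: "(\<And>i. coord x i = coord y i) \<Longrightarrow> x = y"
  by (simp add: coord_inject[symmetric] fun_eq_iff)

instantiation c00 :: real_vector
begin

lift_definition zero_c00 :: c00 is "\<lambda>_. 0" by simp
lift_definition plus_c00 :: "c00 \<Rightarrow> c00 \<Rightarrow> c00" is "\<lambda>x y i. x i + y i"
proof -
  fix x y :: "nat \<Rightarrow> real" assume "finite {i. x i \<noteq> 0}" "finite {i. y i \<noteq> 0}"
  then show "finite {i. x i + y i \<noteq> 0}"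
    by (rule finite_subset[rotated, OF finite_UnI]) auto
qed
lift_definition uminus_c00 :: "c00 \<Rightarrow> c00" is "\<lambda>x i. - x i" by simp
lift_definition minus_c00 :: "c00 \<Rightarrow> c00 \<Rightarrow> c00" is "\<lambda>x y i. x i - y i"
proof -
  fix x y :: "nat \<Rightarrow> real" assume "finite {i. x i \<noteq> 0}" "finite {i. y i \<noteq> 0}"
  then show "finite {i. x i - y i \<noteq> 0}"
    by (rule finite_subset[rotated, OF finite_UnI]) auto
qed
lift_definition scaleR_c00 :: "real \<Rightarrow> c00 \<Rightarrow> c00" is "\<lambda>a x i. a * x i" by simp

instance
  by standard (transfer; simp add: fun_eq_iff algebra_simps)+

end

lift_definition restr :: "nat set \<Rightarrow> c00 \<Rightarrow> c00" is "\<lambda>E x i. if i \<in> E then x i else 0"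
  by (rule finite_subset[rotated]) auto

lemmas coord_simps [simp] = zero_c00.rep_eq plus_c00.rep_eq uminus_c00.rep_eq minus_c00.rep_eq
  scaleR_c00.rep_eq restr.rep_eq

definition sup_norm :: "c00 \<Rightarrow> real" where
  "sup_norm x = (SUP i. \<bar>coord x i\<bar>)"

definition successive :: "nat \<Rightarrow> (nat \<Rightarrow> nat set) \<Rightarrow> bool" where
  "successive k E \<longleftrightarrow> (\<forall>j<k. finite (E j) \<and> E j \<noteq> {}) \<and>
     (\<forall>j. Suc j < k \<longrightarrow> Max (E j) < Min (E (Suc j)))"

definition schl_f :: "nat \<Rightarrow> real" where
  "schl_f k = log 2 (real k + 1)"

definition is_norm :: "('a::real_vector \<Rightarrow> real) \<Rightarrow> bool" where
  "is_norm N \<longleftrightarrow> (\<forall>x. N x = 0 \<longleftrightarrow> x = 0) \<and> (\<forall>x y. N (x + y) \<le> N x + N y) \<and>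
     (\<forall>a x. N (a *\<^sub>R x) = \<bar>a\<bar> * N x)"

text \<open>For \<open>N 0 = 0\<close> the set below is nonempty and bounded above (\<open>schl_averages_nonempty\<close>,
  \<open>schl_averages_bdd\<close>), so the real-valued \<open>Sup\<close> in the implicit equation is a genuine supremum.
  The sets \<open>E\<^sub>1 < \<dots> < E\<^sub>k\<close> are indexed by \<open>0, \<dots>, k - 1\<close>.\<close>

definition schl_averages :: "(c00 \<Rightarrow> real) \<Rightarrow> c00 \<Rightarrow> real set" where
  "schl_averages N x =
     {1 / schl_f k * (\<Sum>j<k. N (restr (E j) x)) | k E. k \<ge> 2 \<and> successive k E}"

definition schl_equation :: "(c00 \<Rightarrow> real) \<Rightarrow> bool" where
  "schl_equation N \<longleftrightarrow> (\<forall>x. N x = max (sup_norm x) (Sup (schl_averages N x)))"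

lemma sup_norm_bdd: "bdd_above (range (\<lambda>i. \<bar>coord x i\<bar>))"
proof -
  have "range (\<lambda>i. \<bar>coord x i\<bar>) \<subseteq> insert 0 ((\<lambda>i. \<bar>coord x i\<bar>) ` {i. coord x i \<noteq> 0})" by auto
  then have "finite (range (\<lambda>i. \<bar>coord x i\<bar>))" by (rule finite_subset) simp
  then show ?thesis by (rule bdd_above_finite)
qed

lemma coord_le_sup_norm: "\<bar>coord x i\<bar> \<le> sup_norm x"
  unfolding sup_norm_def by (rule cSUP_upper[OF UNIV_I sup_norm_bdd])

lemma successive_less:
  assumes "successive k E" "i < j" "j < k" "a \<in> E i" "b \<in> E j"
  shows "a < b"
  using assms(2-)
proof (induction j arbitrary: b)
  case (Suc j)
  have fin: "finite (E j)" "finite (E (Suc j))" "E j \<noteq> {}"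
    and M: "Max (E j) < Min (E (Suc j))"
    using assms(1) Suc.prems by (auto simp: successive_def)
  have b: "Max (E j) < b" using fin M Suc.prems Min_le[of "E (Suc j)" b] by linarith
  show ?case
  proof (cases "i = j")
    case True
    then show ?thesis using b fin Suc.prems Max_ge[of "E j" a] by simp
  next
    case False
    then have "a < Max (E j)" using Suc fin by (intro Suc.IH) (auto intro: Max_in)
    then show ?thesis using b by simp
  qed
qed simp

lemma successive_unique:
  assumes "successive k E" "i < k" "j < k" "a \<in> E i" "a \<in> E j"
  shows "i = j"
  using successive_less[OF assms(1)] assms(2-) by (metis less_irrefl nat_neq_iff)

lemma successive_card: "successive k E \<Longrightarrow> card {j. j < k \<and> i \<in> E j} \<le> 1"
  by (rule card_le_Suc0_iff_eq[THEN iffD2, unfolded One_nat_def[symmetric]]) (auto intro: successive_unique)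

lemma successive_singletons: "successive k (\<lambda>j. {j})"
  by (simp add: successive_def)

lemma schl_f_gt1: "k \<ge> 2 \<Longrightarrow> schl_f k > 1"
  by (simp add: schl_f_def less_log_iff)

lemma schl_averages_nonempty: "schl_averages N x \<noteq> {}"
  unfolding schl_averages_def using successive_singletons[of 2] by blast

lemma schl_averages_bdd:
  assumes "N 0 = 0"
  shows "bdd_above (schl_averages N x)"
proof -
  let ?s = "{i. coord x i \<noteq> 0}"
  let ?R = "(\<lambda>A. \<bar>N (restr A x)\<bar>) ` Pow ?s"
  define B where "B = Max ?R"
  have fin: "finite ?R" by simp
  have le: "\<bar>N (restr E x)\<bar> \<le> B * card (E \<inter> ?s)" for E
  proof -
    have eq: "restr E x = restr (E \<inter> ?s) x" by (rule c00_eqI) auto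
    have B: "\<bar>N (restr E x)\<bar> \<le> B"
      unfolding B_def eq by (rule Max_ge[OF fin]) auto
    show ?thesis
    proof (cases "E \<inter> ?s = {}")
      case True
      then have "restr E x = 0" unfolding eq by (intro c00_eqI) simp
      then show ?thesis using True assms by simp
    next
      case False
      then have "1 \<le> real (card (E \<inter> ?s))"
        by (metis One_nat_def Suc_leI card_gt_0_iff finite_Int finite_coord of_nat_1 of_nat_mono)
      moreover have "0 \<le> B" using B by linarith
      ultimately show ?thesis using B mult_left_mono[of 1 "real (card (E \<inter> ?s))" B] by simp
    qed
  qed
  have B0: "0 \<le> B" 
    unfolding B_def by (rule order_trans[OF abs_ge_zero Max_ge[OF fin]]) auto
  have "1 / schl_f k * (\<Sum>j<k. N (restr (E j) x)) \<le> B * card ?s"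
    if "k \<ge> 2" "successive k E" for k E
  proof -
    have "(\<Sum>j<k. N (restr (E j) x)) \<le> (\<Sum>j<k. B * card (E j \<inter> ?s))"
      by (intro sum_mono) (use le in \<open>auto intro: order_trans[OF abs_ge_self]\<close>)
    also have "\<dots> = B * real (\<Sum>j<k. card (E j \<inter> ?s))"
      by (simp add: sum_distrib_left)
    also have "(\<Sum>j<k. card (E j \<inter> ?s)) = card (\<Union>j<k. E j \<inter> ?s)"
      by (rule card_UN_disjoint[symmetric]) (auto dest: successive_unique[OF that(2)])
    also have "B * real \<dots> \<le> B * card ?s"
      by (intro mult_left_mono of_nat_mono card_mono B0) auto
    finally have *: "(\<Sum>j<k. N (restr (E j) x)) \<le> B * card ?s" .
    have f: "schl_f k > 1" using that by (simp add: schl_f_gt1)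
    have "B * card ?s \<le> schl_f k * (B * card ?s)"
      using f B0 mult_right_mono[of 1 "schl_f k" "B * card ?s"] by simp
    then have "(\<Sum>j<k. N (restr (E j) x)) \<le> schl_f k * (B * card ?s)" using * by linarith
    then show ?thesis using f by (simp add: field_simps)
  qed
  then show ?thesis unfolding schl_averages_def bdd_above_def by blast
qed

text \<open>Uniqueness of the solution: in the implicit equation only restrictions of \<open>x\<close> with smaller
  support matter, because \<open>1 / schl_f k < 1\<close>.\<close>

lemma is_norm_nonneg:
  assumes "is_norm N" shows "N x \<ge> 0"
proof -
  have "N 0 \<le> N x + N (- x)" using assms unfolding is_norm_def by (metis add.right_inverse)
  moreover have "N (- x) = N x" using assms unfolding is_norm_def
    by (metis abs_minus abs_one mult_1 scaleR_minus1_left)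
  moreover have "N 0 = 0" using assms by (simp add: is_norm_def)
  ultimately show ?thesis by simp
qed

lemma schl_equation_le:
  assumes N: "is_norm N" "schl_equation N" and M: "is_norm M" "schl_equation M"
  shows "N x \<le> M x"
proof (induction "card {i. coord x i \<noteq> 0}" arbitrary: x rule: less_induct)
  case less
  have z: "N 0 = 0" "M 0 = 0" using N M by (auto simp: is_norm_def)
  have Mx: "M x = max (sup_norm x) (Sup (schl_averages M x))"
    and Nx: "N x = max (sup_norm x) (Sup (schl_averages N x))"
    using N M by (auto simp: schl_equation_def)
  have "t \<le> max (M x) (N x / schl_f 2)" if tin: "t \<in> schl_averages N x" for t
  proof -
    obtain k E where k: "k \<ge> 2" "successive k E"
      and t: "t = 1 / schl_f k * (\<Sum>j<k. N (restr (E j) x))"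
      using tin unfolding schl_averages_def by blast
    have f: "schl_f k \<ge> schl_f 2" "schl_f 2 > 1"
      using k by (auto simp: schl_f_gt1) (auto simp: schl_f_def)
    show ?thesis
    proof (cases "\<exists>j<k. restr (E j) x = x")
      case True
      then obtain j where j: "j < k" "restr (E j) x = x" by blast
      have "restr (E i) x = 0" if "i < k" "i \<noteq> j" for i
      proof (rule c00_eqI)
        fix n
        have "coord x n = 0" if "n \<notin> E j"
          using that j(2) by (metis restr.rep_eq)
        then show "coord (restr (E i) x) n = coord 0 n"
          using successive_unique[OF k(2) \<open>i < k\<close> j(1)] \<open>i \<noteq> j\<close> by auto
      qed
      then have "(\<Sum>i<k. N (restr (E i) x)) = (\<Sum>i<k. if i = j then N x else 0)"
        using j z by (intro sum.cong) auto
      also have "\<dots> = N x" using j by simp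
      finally have "t = N x / schl_f k" using t by simp
      also have "\<dots> \<le> N x / schl_f 2"
        using f is_norm_nonneg[OF N(1)] by (intro divide_left_mono) auto
      finally show ?thesis by simp
    next
      case False
      have "N (restr (E j) x) \<le> M (restr (E j) x)" if "j < k" for j
      proof (rule less.hyps, rule psubset_card_mono)
        have "restr (E j) x \<noteq> x" using False that by blast
        then obtain n where "coord (restr (E j) x) n \<noteq> coord x n" using c00_eqI by blast
        then have "coord x n \<noteq> 0" "coord (restr (E j) x) n = 0" by (auto split: if_splits)
        then show "{i. coord (restr (E j) x) i \<noteq> 0} \<subset> {i. coord x i \<noteq> 0}"
          by (auto split: if_splits)
      qed simp
      then have "t \<le> 1 / schl_f k * (\<Sum>j<k. M (restr (E j) x))"
        unfolding t using f by (intro mult_left_mono sum_mono) auto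
      also have "\<dots> \<le> Sup (schl_averages M x)"
        by (rule cSup_upper[OF _ schl_averages_bdd[where N=M, OF z(2)]]) (use k in \<open>auto simp: schl_averages_def\<close>)
      also have "\<dots> \<le> M x" using Mx by simp
      finally show ?thesis by simp
    qed
  qed
  then have "Sup (schl_averages N x) \<le> max (M x) (N x / schl_f 2)"
    by (intro cSup_least schl_averages_nonempty)
  moreover have "sup_norm x \<le> M x" using Mx by simp
  ultimately have le: "N x \<le> max (M x) (N x / schl_f 2)" using Nx by auto
  have f: "schl_f 2 > 1" by (simp add: schl_f_gt1)
  show ?case
  proof (rule ccontr)
    assume "\<not> N x \<le> M x"
    moreover have "M x \<ge> 0" by (rule is_norm_nonneg[OF M(1)])
    ultimately have "N x > 0" "N x \<le> N x / schl_f 2" using le by auto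
    then show False using f by (simp add: field_simps)
  qed
qed

text \<open>Existence of the solution: the supremum over a norming set of functionals.\<close>

inductive schl_norming :: "(nat \<Rightarrow> real) \<Rightarrow> bool" where
  unit: "\<bar>s\<bar> = 1 \<Longrightarrow> schl_norming (\<lambda>i. if i = n then s else 0)"
| average: "k \<ge> 2 \<Longrightarrow> successive k E \<Longrightarrow> (\<And>j. j < k \<Longrightarrow> schl_norming (g j)) \<Longrightarrow>
     schl_norming (\<lambda>i. (\<Sum>j<k. if i \<in> E j then g j i else 0) / schl_f k)"

definition pairing :: "(nat \<Rightarrow> real) \<Rightarrow> c00 \<Rightarrow> real" where
  "pairing g x = (\<Sum>i | coord x i \<noteq> 0. g i * coord x i)"

definition norming_sup :: "c00 \<Rightarrow> real" where
  "norming_sup x = (SUP g\<in>Collect schl_norming. pairing g x)"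

lemma pairing_eq:
  assumes "finite A" "{i. coord x i \<noteq> 0} \<subseteq> A"
  shows "pairing g x = (\<Sum>i\<in>A. g i * coord x i)"
  unfolding pairing_def by (rule sum.mono_neutral_left) (use assms in auto)

lemma pairing_add: "pairing g (x + y) = pairing g x + pairing g y"
proof -
  let ?A = "{i. coord x i \<noteq> 0} \<union> {i. coord y i \<noteq> 0}"
  have "pairing g z = (\<Sum>i\<in>?A. g i * coord z i)" if "z = x + y \<or> z = x \<or> z = y" for z
    by (rule pairing_eq) (use that in auto)
  then show ?thesis by (simp add: sum.distrib algebra_simps)
qed

lemma pairing_scaleR: "pairing g (a *\<^sub>R x) = a * pairing g x"
  using pairing_eq[of "{i. coord x i \<noteq> 0}" "a *\<^sub>R x" g]
  by (simp add: pairing_def sum_distrib_left algebra_simps subset_eq)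

lemma pairing_uminus: "pairing (\<lambda>i. - g i) x = - pairing g x"
  by (simp add: pairing_def sum_negf)

lemma pairing_average:
  "pairing (\<lambda>i. (\<Sum>j<k. if i \<in> E j then g j i else 0) / c) x
     = 1 / c * (\<Sum>j<k. pairing (g j) (restr (E j) x))"
proof -
  let ?A = "{i. coord x i \<noteq> 0}"
  have *: "pairing (g j) (restr (E j) x) = (\<Sum>i\<in>?A. (if i \<in> E j then g j i else 0) * coord x i)" for j
    by (subst pairing_eq[of ?A]) (auto intro!: sum.cong split: if_splits)
  have "1 / c * (\<Sum>j<k. pairing (g j) (restr (E j) x))
      = 1 / c * (\<Sum>i\<in>?A. \<Sum>j<k. (if i \<in> E j then g j i else 0) * coord x i)"
    by (simp only: * sum.swap[of _ ?A])
  also have "\<dots> = (\<Sum>i\<in>?A. (\<Sum>j<k. if i \<in> E j then g j i else 0) / c * coord x i)"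
    by (simp only: sum_distrib_right[symmetric] sum_distrib_left) (simp add: algebra_simps)
  finally show ?thesis by (simp add: pairing_def)
qed

lemma schl_norming_bound: "schl_norming g \<Longrightarrow> \<bar>g i\<bar> \<le> 1"
proof (induction arbitrary: i rule: schl_norming.induct)
  case (average k E g)
  have "\<bar>\<Sum>j<k. if i \<in> E j then g j i else 0\<bar> \<le> (\<Sum>j<k. \<bar>if i \<in> E j then g j i else 0\<bar>)"
    by (rule sum_abs)
  also have "\<dots> \<le> (\<Sum>j<k. if i \<in> E j then 1 else 0)"
    using average.IH by (intro sum_mono) auto
  also have "\<dots> = real (card {j. j < k \<and> i \<in> E j})"
    by (simp add: sum.If_cases Int_def)
  also have "\<dots> \<le> 1" using successive_card[OF average.hyps(2), of i] by simp
  finally show ?case using schl_f_gt1[OF average.hyps(1)] by (simp add: divide_le_eq)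
qed auto

lemma schl_norming_uminus: "schl_norming g \<Longrightarrow> schl_norming (\<lambda>i. - g i)"
proof (induction rule: schl_norming.induct)
  case (unit s n)
  then show ?case using schl_norming.unit[of "- s" n] by (simp add: if_distrib cong: if_cong)
next
  case (average k E g)
  have "(\<lambda>i. - ((\<Sum>j<k. if i \<in> E j then g j i else 0) / schl_f k))
      = (\<lambda>i. (\<Sum>j<k. if i \<in> E j then - g j i else 0) / schl_f k)"
  proof
    fix i
    have "- (\<Sum>j<k. if i \<in> E j then g j i else 0) = (\<Sum>j<k. if i \<in> E j then - g j i else 0)"
      unfolding sum_negf[symmetric] by (rule sum.cong) auto
    then show "- ((\<Sum>j<k. if i \<in> E j then g j i else 0) / schl_f k)
        = (\<Sum>j<k. if i \<in> E j then - g j i else 0) / schl_f k"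
      by (simp add: minus_divide_left)
  qed
  then show ?case
    using schl_norming.average[OF average.hyps(1,2), of "\<lambda>j i. - g j i"] average.IH by simp
qed

lemma norming_bdd: "bdd_above ((\<lambda>g. pairing g x) ` Collect schl_norming)"
proof (rule bdd_aboveI2)
  fix g assume "g \<in> Collect schl_norming"
  then have "\<bar>g i\<bar> \<le> 1" for i using schl_norming_bound by simp
  then have "\<bar>g i * coord x i\<bar> \<le> \<bar>coord x i\<bar>" for i
    unfolding abs_mult by (rule mult_left_le_one_le[OF abs_ge_zero abs_ge_zero])
  then have "g i * coord x i \<le> \<bar>coord x i\<bar>" for i
    by (rule order_trans[OF abs_ge_self])
  then show "pairing g x \<le> (\<Sum>i | coord x i \<noteq> 0. \<bar>coord x i\<bar>)"
    unfolding pairing_def by (rule sum_mono)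
qed

lemma norming_nonempty: "Collect schl_norming \<noteq> {}"
  using schl_norming.unit[of 1] by fastforce

lemma pairing_le_norming_sup: "schl_norming g \<Longrightarrow> pairing g x \<le> norming_sup x"
  unfolding norming_sup_def by (rule cSUP_upper[OF _ norming_bdd]) simp

lemma norming_sup_least: "(\<And>g. schl_norming g \<Longrightarrow> pairing g x \<le> c) \<Longrightarrow> norming_sup x \<le> c"
  unfolding norming_sup_def by (rule cSUP_least[OF norming_nonempty]) simp

lemma coord_le_norming_sup: "\<bar>coord x n\<bar> \<le> norming_sup x"
proof -
  define s :: real where "s = (if coord x n \<ge> 0 then 1 else -1)"
  let ?g = "\<lambda>i. if i = n then s else 0"
  have "pairing ?g x = (\<Sum>i\<in>insert n {i. coord x i \<noteq> 0}. ?g i * coord x i)"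
    by (rule pairing_eq) auto
  also have "\<dots> = (\<Sum>i\<in>insert n {i. coord x i \<noteq> 0}. if i = n then s * coord x n else 0)"
    by (intro sum.cong) auto
  also have "\<dots> = s * coord x n" by (subst sum.delta) auto
  also have "\<dots> = \<bar>coord x n\<bar>" by (simp add: s_def)
  finally show ?thesis using pairing_le_norming_sup[OF schl_norming.unit[of s n], of x]
    by (simp add: s_def)
qed

lemma is_norm_norming_sup: "is_norm norming_sup"
  unfolding is_norm_def
proof (intro conjI allI)
  fix x y :: c00 and a :: real
  have scale_le: "norming_sup (b *\<^sub>R z) \<le> \<bar>b\<bar> * norming_sup z" for b z
  proof (rule norming_sup_least)
    fix g assume g: "schl_norming g"
    have "pairing g z \<le> norming_sup z" "- pairing g z \<le> norming_sup z"
      using pairing_le_norming_sup[OF g] pairing_le_norming_sup[OF schl_norming_uminus[OF g]]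
      by (auto simp: pairing_uminus)
    then have "\<bar>b * pairing g z\<bar> \<le> \<bar>b\<bar> * norming_sup z"
      unfolding abs_mult by (intro mult_left_mono) auto
    then show "pairing g (b *\<^sub>R z) \<le> \<bar>b\<bar> * norming_sup z" by (simp add: pairing_scaleR)
  qed
  have zero: "norming_sup 0 = 0"
    using scale_le[of 0 0] coord_le_norming_sup[of 0 0] by simp
  show "norming_sup x = 0 \<longleftrightarrow> x = 0"
  proof
    assume "norming_sup x = 0"
    then show "x = 0" using coord_le_norming_sup[of x] by (intro c00_eqI) simp
  qed (simp add: zero)
  show "norming_sup (x + y) \<le> norming_sup x + norming_sup y"
    by (rule norming_sup_least) (simp add: pairing_add add_mono pairing_le_norming_sup)
  show "norming_sup (a *\<^sub>R x) = \<bar>a\<bar> * norming_sup x"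
  proof (cases "a = 0")
    case True
    then show ?thesis by (simp add: zero)
  next
    case False
    have "norming_sup x \<le> \<bar>1 / a\<bar> * norming_sup (a *\<^sub>R x)"
      using scale_le[of "1 / a" "a *\<^sub>R x"] False by simp
    then have "\<bar>a\<bar> * norming_sup x \<le> norming_sup (a *\<^sub>R x)"
      using False by (simp add: field_simps)
    then show ?thesis using scale_le[of a x] by simp
  qed
qed

lemma schl_equation_norming_sup: "schl_equation norming_sup"
  unfolding schl_equation_def
proof (intro allI antisym)
  fix x
  have z: "norming_sup 0 = 0" using is_norm_norming_sup by (simp add: is_norm_def)
  show "norming_sup x \<le> max (sup_norm x) (Sup (schl_averages norming_sup x))"
  proof (rule norming_sup_least)
    fix g assume "schl_norming g"
    then show "pairing g x \<le> max (sup_norm x) (Sup (schl_averages norming_sup x))"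
    proof cases
      case (unit s n)
      have "pairing g x = (\<Sum>i\<in>insert n {i. coord x i \<noteq> 0}. g i * coord x i)"
        by (rule pairing_eq) auto
      also have "\<dots> = (\<Sum>i\<in>insert n {i. coord x i \<noteq> 0}. if i = n then s * coord x n else 0)"
        by (intro sum.cong) (auto simp: unit)
      also have "\<dots> = s * coord x n" by (subst sum.delta) auto
      also have "\<dots> \<le> \<bar>coord x n\<bar>" using unit by (metis abs_ge_self abs_mult mult_1)
      also have "\<dots> \<le> sup_norm x" by (rule coord_le_sup_norm)
      finally show ?thesis by simp
    next
      case (average k E h)
      have "pairing g x = 1 / schl_f k * (\<Sum>j<k. pairing (h j) (restr (E j) x))"
        unfolding average(1) by (rule pairing_average)
      also have "\<dots> \<le> 1 / schl_f k * (\<Sum>j<k. norming_sup (restr (E j) x))"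
        using schl_f_gt1[OF average(2)] average(4)
        by (intro mult_left_mono sum_mono pairing_le_norming_sup) auto
      also have "\<dots> \<le> Sup (schl_averages norming_sup x)"
        by (rule cSup_upper[OF _ schl_averages_bdd[where N=norming_sup, OF z]])
          (use average in \<open>auto simp: schl_averages_def\<close>)
      finally show ?thesis by simp
    qed
  qed
  have "1 / schl_f k * (\<Sum>j<k. norming_sup (restr (E j) x)) \<le> norming_sup x"
    if k: "k \<ge> 2" and E: "successive k E" for k E
  proof (rule field_le_epsilon)
    fix e :: real assume e: "0 < e"
    have f: "schl_f k > 1" using k by (rule schl_f_gt1)
    have "\<exists>g. schl_norming g \<and> norming_sup (restr (E j) x) - e / k < pairing g (restr (E j) x)" for j
      using less_cSUP_iff[OF norming_nonempty norming_bdd,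
          of "norming_sup (restr (E j) x) - e / k" "restr (E j) x"] k e
      by (auto simp: norming_sup_def)
    then obtain g where g: "\<And>j. schl_norming (g j)"
      "\<And>j. norming_sup (restr (E j) x) - e / k < pairing (g j) (restr (E j) x)" by metis
    have "(\<Sum>j<k. norming_sup (restr (E j) x)) \<le> (\<Sum>j<k. pairing (g j) (restr (E j) x) + e / k)"
      using g(2) by (intro sum_mono) (simp add: less_imp_le diff_less_eq[symmetric])
    also have "\<dots> = (\<Sum>j<k. pairing (g j) (restr (E j) x)) + e"
      using k by (simp add: sum.distrib)
    finally have "1 / schl_f k * (\<Sum>j<k. norming_sup (restr (E j) x))
        \<le> 1 / schl_f k * ((\<Sum>j<k. pairing (g j) (restr (E j) x)) + e)"
      using f by (intro mult_left_mono) auto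
    also have "\<dots> = 1 / schl_f k * (\<Sum>j<k. pairing (g j) (restr (E j) x)) + e / schl_f k"
      by (simp add: algebra_simps)
    also have "\<dots> = pairing (\<lambda>i. (\<Sum>j<k. if i \<in> E j then g j i else 0) / schl_f k) x + e / schl_f k"
      by (simp add: pairing_average)
    also have "\<dots> \<le> norming_sup x + e"
      using f e by (intro add_mono pairing_le_norming_sup schl_norming.average k E g(1))
        (simp add: field_simps)
    finally show "1 / schl_f k * (\<Sum>j<k. norming_sup (restr (E j) x)) \<le> norming_sup x + e" .
  qed
  then have "Sup (schl_averages norming_sup x) \<le> norming_sup x"
    by (intro cSup_least schl_averages_nonempty) (auto simp: schl_averages_def)
  moreover have "sup_norm x \<le> norming_sup x"
    unfolding sup_norm_def by (rule cSUP_least) (auto simp: coord_le_norming_sup)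
  ultimately show "max (sup_norm x) (Sup (schl_averages norming_sup x)) \<le> norming_sup x" by simp
qed

lemma ex1_schl_norm: "\<exists>!N. is_norm N \<and> schl_equation N"
proof (rule ex1I[of _ norming_sup])
  show "is_norm norming_sup \<and> schl_equation norming_sup"
    by (simp add: is_norm_norming_sup schl_equation_norming_sup)
  fix N assume "is_norm N \<and> schl_equation N"
  then show "N = norming_sup"
    using schl_equation_le is_norm_norming_sup schl_equation_norming_sup
    by (intro ext antisym) auto
qed

instantiation c00 :: real_normed_vector
begin

definition norm_c00 :: "c00 \<Rightarrow> real" where
  "norm_c00 = (THE N. is_norm N \<and> schl_equation N)"

definition dist_c00 :: "c00 \<Rightarrow> c00 \<Rightarrow> real" where
  "dist_c00 x y = norm (x - y)"

definition sgn_c00 :: "c00 \<Rightarrow> c00" where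
  "sgn_c00 x = x /\<^sub>R norm x"

definition uniformity_c00 :: "(c00 \<times> c00) filter" where
  "uniformity_c00 = (INF e\<in>{0 <..}. principal {(x, y). dist x y < e})"

definition open_c00 :: "c00 set \<Rightarrow> bool" where
  "open_c00 S = (\<forall>x\<in>S. \<forall>\<^sub>F (x', y) in uniformity. x' = x \<longrightarrow> y \<in> S)"

instance
proof
  fix x y :: c00 and a :: real and S :: "c00 set"
  have N: "is_norm (norm :: c00 \<Rightarrow> real)"
    unfolding norm_c00_def using theI'[OF ex1_schl_norm] by blast
  show "dist x y = norm (x - y)" by (rule dist_c00_def)
  show "sgn x = x /\<^sub>R norm x" by (rule sgn_c00_def)
  show "(uniformity :: (c00 \<times> c00) filter) = (INF e\<in>{0 <..}. principal {(x, y). dist x y < e})"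
    by (rule uniformity_c00_def)
  show "open S = (\<forall>x\<in>S. \<forall>\<^sub>F (x', y) in uniformity. x' = x \<longrightarrow> y \<in> S)"
    by (rule open_c00_def)
  show "norm x = 0 \<longleftrightarrow> x = 0" "norm (x + y) \<le> norm x + norm y" "norm (a *\<^sub>R x) = \<bar>a\<bar> * norm x"
    using N by (auto simp: is_norm_def)
qed

end

lemma schl_equation_norm: "schl_equation (norm :: c00 \<Rightarrow> real)"
  unfolding norm_c00_def using theI'[OF ex1_schl_norm] by blast

type_synonym schlumprecht = "c00 completion"

section \<open>Asymptotic symmetry\<close>

definition weakly_null :: "(nat \<Rightarrow> 'a::real_normed_vector) \<Rightarrow> bool" where
  "weakly_null x \<longleftrightarrow> (\<forall>\<phi> :: 'a \<Rightarrow> real. bounded_linear \<phi> \<longrightarrow> (\<lambda>n. \<phi> (x n)) \<longlonglongrightarrow> 0)"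

definition normalized :: "(nat \<Rightarrow> 'a::real_normed_vector) \<Rightarrow> bool" where
  "normalized x \<longleftrightarrow> (\<forall>n. norm (x n) = 1)"

text \<open>\<open>has_iterated_lim [i\<^sub>1, \<dots>, i\<^sub>m] F n L\<close> means that the iterated limit of \<open>F n\<close> exists and equals
  \<open>L\<close>, where first the index \<open>n i\<^sub>m\<close> tends to infinity, then the index before it in the list, and
  finally \<open>n i\<^sub>1\<close>; the remaining indices are fixed by \<open>n\<close>.\<close>

primrec has_iterated_lim ::
  "nat list \<Rightarrow> ((nat \<Rightarrow> nat) \<Rightarrow> real) \<Rightarrow> (nat \<Rightarrow> nat) \<Rightarrow> real \<Rightarrow> bool" where
  "has_iterated_lim [] F n L \<longleftrightarrow> L = F n"
| "has_iterated_lim (i # is) F n L \<longleftrightarrow>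
     (\<exists>g. (\<forall>k. has_iterated_lim is F (n(i := k)) (g k)) \<and> g \<longlonglongrightarrow> L)"

text \<open>The sequences are indexed by \<open>0, \<dots>, m - 1\<close>. The starting assignment \<open>\<lambda>_. 0\<close> is irrelevant:
  each of the indices occurring in the norm is assigned by one of the limits.\<close>

definition wnas :: "'a::banach itself \<Rightarrow> bool" where
  "wnas _ \<longleftrightarrow> (\<exists>C :: real. \<forall>(m :: nat) (x :: nat \<Rightarrow> nat \<Rightarrow> 'a) \<sigma> L L'.
     (\<forall>i<m. normalized (x i) \<and> weakly_null (x i)) \<longrightarrow>
     \<sigma> permutes {..<m} \<longrightarrow>
     has_iterated_lim [0..<m] (\<lambda>n. norm (\<Sum>i<m. x i (n i))) (\<lambda>_. 0) L \<longrightarrow>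
     has_iterated_lim (map \<sigma> [0..<m]) (\<lambda>n. norm (\<Sum>i<m. x i (n i))) (\<lambda>_. 0) L' \<longrightarrow>
     L \<le> C * L')"

end

theory Submission
  imports Defs "HOL-Real_Asymp.Real_Asymp"
begin

text \<open>
  The norm of \<open>S\<close> is invariant under spreading the coordinates, but not under permuting successive
  blocks, and this can be felt by shifts of finitely many fixed blocks.

  Take \<open>r\<close> types of blocks, the type \<open>i\<close> being a normalized flat vector of length \<open>n i\<close>, where the
  lengths grow very rapidly, and \<open>s\<close> copies of each type, with \<open>s\<close> much larger than \<open>r\<close>. Copies of one
  type that stand next to each other form one long flat vector. Since \<open>schl_f\<close> varies slowly, the
  lengths can be chosen such that the norm of this vector is comparable to \<open>s\<close>. Therefore, if the
  blocks are grouped by types, then splitting the sum into its \<open>r\<close> groups shows that its norm is at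
  least a constant times \<open>r * s / schl_f r\<close> (\<open>grouped_norm_ge\<close>).

  If the types are repeated cyclically, then the norm is at most a constant times \<open>s\<close>
  (\<open>cyclic_norm_le\<close>). Averages over \<open>k\<close> pieces with \<open>k\<close> large are efficient for at most one type: for
  short blocks the denominator \<open>schl_f k\<close> is much larger than their \<open>\<ell>\<^sub>1\<close> norm, and long blocks gain
  almost nothing from being split, while a factor \<open>schl_f k \<ge> r\<close> is lost. In a cyclic arrangement every
  interval contains the types in almost equal proportion, so that such an average is bounded by about
  the number of blocks in the interval divided by \<open>r\<close>. Averages over few pieces gain little: even if
  they are iterated, the gain is absorbed by a term \<open>t powr (1 - \<epsilon>)\<close> in the number \<open>t\<close> of blocks
  (\<open>norm_le_linear_plus_power\<close>), and this term is at most \<open>s\<close> for \<open>t = r * s\<close> if \<open>s\<close> is large.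
  These upper estimates are supersolutions of the implicit equation of the norm
  (\<open>norm_le_supersolution\<close>).

  The shifts of a fixed block form a weakly null sequence, because \<open>n\<close> unit vectors have a sum of norm
  \<open>o(n)\<close> (\<open>weakly_null_unit_vectors\<close>). By the invariance under spreading, the iterated limits exist
  and are equal to the norm of one sum of blocks which follow one another in the prescribed order
  (\<open>has_iterated_lim_flat\<close>). The quotient of the two limits is at least a constant times
  \<open>r / schl_f r\<close>, which is unbounded.
\<close>

section \<open>Estimating the norm\<close>

lemma schl_f_mono: "k \<le> l \<Longrightarrow> schl_f k \<le> schl_f l"
  by (simp add: schl_f_def)

lemma schl_f_ge1: "1 \<le> k \<Longrightarrow> 1 \<le> schl_f k"
  by (simp add: schl_f_def le_log_iff)

lemma schl_f_unbounded: "\<exists>k. c \<le> schl_f k"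
proof -
  obtain k :: nat where "2 powr c \<le> real k" using real_arch_simple by blast
  then have "c \<le> schl_f k" unfolding schl_f_def by (subst le_log_iff) auto
  then show ?thesis ..
qed

lemma norm_c00_eq: "norm (x :: c00) = max (sup_norm x) (Sup (schl_averages norm x))"
  using schl_equation_norm by (simp add: schl_equation_def)

lemma coord_le_norm: "\<bar>coord x i\<bar> \<le> norm x"
  using coord_le_sup_norm[of x i] norm_c00_eq[of x] by simp

lemma successive_sum_le_norm:
  assumes "2 \<le> k" "successive k D"
  shows "(\<Sum>j<k. norm (restr (D j) x)) \<le> schl_f k * norm x"
proof -
  have "1 / schl_f k * (\<Sum>j<k. norm (restr (D j) x)) \<le> Sup (schl_averages norm x)"
    by (rule cSup_upper[OF _ schl_averages_bdd]) (use assms in \<open>auto simp: schl_averages_def\<close>)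
  also have "\<dots> \<le> norm x" using norm_c00_eq[of x] by simp
  finally show ?thesis using schl_f_gt1[OF assms(1)] by (simp add: field_simps)
qed

text \<open>Upper estimates for the norm come from supersolutions of the implicit equation. The averages in
  which one piece carries the whole of \<open>restr E x\<close> are harmless because of the factor
  \<open>1 / schl_f k < 1\<close>, and the pieces of all other averages have a smaller support, which makes an
  induction on the size of the support possible.\<close>

lemma norm_le_supersolution:
  assumes coord: "\<And>E i. i \<in> E \<Longrightarrow> \<bar>coord x i\<bar> \<le> G E"
    and nonneg: "\<And>E. 0 \<le> G E"
    and split: "\<And>E k D. 2 \<le> k \<Longrightarrow> successive k D \<Longrightarrow>
      (\<And>j. j < k \<Longrightarrow> norm (restr (E \<inter> D j) x) \<le> G (E \<inter> D j)) \<Longrightarrow>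
      (\<Sum>j<k. norm (restr (E \<inter> D j) x)) \<le> schl_f k * G E"
  shows "norm (restr E x) \<le> G E"
proof (induction "card {i \<in> E. coord x i \<noteq> 0}" arbitrary: E rule: less_induct)
  case less
  define y where "y = restr E x"
  have f2: "schl_f 2 > 1" by (simp add: schl_f_gt1)
  have yj: "restr D y = restr (E \<inter> D) x" for D
    unfolding y_def by (rule c00_eqI) auto
  have av: "t \<le> max (G E) (norm y / schl_f 2)" if tin: "t \<in> schl_averages norm y" for t
  proof -
    obtain k D where k: "k \<ge> 2" "successive k D"
      and t: "t = 1 / schl_f k * (\<Sum>j<k. norm (restr (D j) y))"
      using tin unfolding schl_averages_def by blast
    have f: "schl_f 2 \<le> schl_f k" using k(1) by (rule schl_f_mono)
    show ?thesis
    proof (cases "\<exists>j<k. restr (D j) y = y")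
      case True
      then obtain j where j: "j < k" "restr (D j) y = y" by blast
      have "restr (D i) y = 0" if "i < k" "i \<noteq> j" for i
      proof (rule c00_eqI)
        fix n
        have "coord y n = 0" if "n \<notin> D j" using that j(2) by (metis restr.rep_eq)
        then show "coord (restr (D i) y) n = coord 0 n"
          using successive_unique[OF k(2) \<open>i < k\<close> j(1)] \<open>i \<noteq> j\<close> by auto
      qed
      then have "(\<Sum>i<k. norm (restr (D i) y)) = (\<Sum>i<k. if i = j then norm y else 0)"
        using j by (intro sum.cong) auto
      also have "\<dots> = norm y" using j by simp
      finally have "t = norm y / schl_f k" using t by simp
      also have "\<dots> \<le> norm y / schl_f 2"
        using f f2 by (intro divide_left_mono) auto
      finally show ?thesis by simp
    next
      case False
      have "norm (restr (E \<inter> D j) x) \<le> G (E \<inter> D j)" if "j < k" for j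
      proof (rule less.hyps, rule psubset_card_mono)
        have "restr (D j) y \<noteq> y" using False that by blast
        then obtain n where "coord (restr (D j) y) n \<noteq> coord y n" using c00_eqI by blast
        then have "n \<in> E" "coord x n \<noteq> 0" "n \<notin> D j" by (auto simp: y_def split: if_splits)
        then show "{i \<in> E \<inter> D j. coord x i \<noteq> 0} \<subset> {i \<in> E. coord x i \<noteq> 0}" by auto
        show "finite {i \<in> E. coord x i \<noteq> 0}"
          by (rule finite_subset[OF _ finite_coord[of x]]) auto
      qed
      then have "(\<Sum>j<k. norm (restr (E \<inter> D j) x)) \<le> schl_f k * G E"
        by (intro split k)
      moreover have "schl_f k * t = (\<Sum>j<k. norm (restr (E \<inter> D j) x))"
        using t f f2 by (simp add: yj)
      ultimately have "schl_f k * t \<le> schl_f k * G E" by simp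
      then have "t \<le> G E" using f f2 by (simp add: mult_le_cancel_left_pos)
      then show ?thesis by simp
    qed
  qed
  have "Sup (schl_averages norm y) \<le> max (G E) (norm y / schl_f 2)"
    by (intro cSup_least schl_averages_nonempty av)
  moreover have "sup_norm y \<le> G E"
    unfolding sup_norm_def using coord nonneg by (intro cSUP_least) (auto simp: y_def)
  ultimately have le: "norm y \<le> max (G E) (norm y / schl_f 2)"
    using norm_c00_eq[of y] by auto
  show ?case
  proof (rule ccontr)
    assume "\<not> ?case"
    then have n: "norm y > G E" by (simp add: y_def)
    then have "norm y \<le> norm y / schl_f 2" using le by auto
    moreover have "norm y > 0" using n nonneg[of E] by linarith
    ultimately show False using f2 by (simp add: field_simps)
  qed
qed

text \<open>Restricting a vector only shrinks the pieces that occur in the implicit equation, so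
  \<open>norm (restr E x)\<close> is a supersolution for the restricted vector.\<close>

lemma norm_restr_le: "norm (restr A x) \<le> norm x"
proof -
  have "norm (restr E (restr A x)) \<le> norm (restr E x)" for E
  proof (rule norm_le_supersolution)
    fix E :: "nat set" and i assume "i \<in> E"
    then show "\<bar>coord (restr A x) i\<bar> \<le> norm (restr E x)"
      using coord_le_norm[of "restr E x" i] by (auto split: if_splits)
  next
    fix E :: "nat set" and k D
    assume k: "2 \<le> k" "successive k D"
      and le: "\<And>j. j < k \<Longrightarrow> norm (restr (E \<inter> D j) (restr A x)) \<le> norm (restr (E \<inter> D j) x)"
    have eq: "restr (E \<inter> D j) x = restr (D j) (restr E x)" for j by (rule c00_eqI) auto
    have "(\<Sum>j<k. norm (restr (E \<inter> D j) (restr A x))) \<le> (\<Sum>j<k. norm (restr (D j) (restr E x)))"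
      using le unfolding eq by (intro sum_mono) auto
    also have "\<dots> \<le> schl_f k * norm (restr E x)" by (rule successive_sum_le_norm[OF k])
    finally show "(\<Sum>j<k. norm (restr (E \<inter> D j) (restr A x))) \<le> schl_f k * norm (restr E x)" .
  qed simp
  from this[of UNIV] show ?thesis
    by (metis (mono_tags, lifting) UNIV_I c00_eqI restr.rep_eq)
qed

text \<open>Unlike \<open>successive\<close>, this notion allows empty and infinite pieces, so that it is inherited by
  subsets, preimages under increasing maps, and interval hulls.\<close>

definition ordered_sets :: "nat \<Rightarrow> (nat \<Rightarrow> nat set) \<Rightarrow> bool" where
  "ordered_sets k F \<longleftrightarrow> (\<forall>i j a b. i < j \<longrightarrow> j < k \<longrightarrow> a \<in> F i \<longrightarrow> b \<in> F j \<longrightarrow> a < b)"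

lemma ordered_setsD: "ordered_sets k F \<Longrightarrow> i < j \<Longrightarrow> j < k \<Longrightarrow> a \<in> F i \<Longrightarrow> b \<in> F j \<Longrightarrow> a < b"
  unfolding ordered_sets_def by blast

lemma successive_ordered: "successive k D \<Longrightarrow> ordered_sets k (\<lambda>j. E \<inter> D j)"
  unfolding ordered_sets_def using successive_less by blast

lemma ordered_sets_disjoint:
  assumes "ordered_sets k F" "i < k" "j < k" "i \<noteq> j"
  shows "F i \<inter> F j = {}"
proof (rule ccontr)
  assume "F i \<inter> F j \<noteq> {}"
  then obtain a where "a \<in> F i" "a \<in> F j" by blast
  then show False
    using assms ordered_setsD[OF assms(1), of i j a a] ordered_setsD[OF assms(1), of j i a a]
    by (metis less_irrefl nat_neq_iff)
qed

text \<open>Empty pieces are dropped. Fewer than two pieces may remain, which the implicit equation does not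
  cover; a single piece is handled by the monotonicity of the norm under restriction.\<close>

lemma ordered_sum_le_norm:
  assumes F: "ordered_sets k F" and k: "1 \<le> k"
  shows "(\<Sum>j<k. norm (restr (F j) x)) \<le> schl_f k * norm x"
proof -
  define S where "S j = F j \<inter> {i. coord x i \<noteq> 0}" for j
  define J where "J = {j \<in> {..<k}. S j \<noteq> {}}"
  have finS: "finite (S j)" for j unfolding S_def by simp
  have finJ: "finite J" "card J \<le> k"
    using card_mono[of "{..<k}" J] by (auto simp: J_def)
  have eq: "restr (F j) x = restr (S j) x" for j by (rule c00_eqI) (auto simp: S_def)
  have z: "restr {} x = 0" by (rule c00_eqI) simp
  have sumJ: "(\<Sum>j<k. norm (restr (F j) x)) = (\<Sum>j\<in>J. norm (restr (S j) x))"
    unfolding eq by (rule sum.mono_neutral_right) (auto simp: J_def z)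
  have f: "schl_f (card J) * norm x \<le> schl_f k * norm x"
    using finJ by (intro mult_right_mono schl_f_mono) auto
  consider "card J = 0" | "card J = 1" | "2 \<le> card J" by linarith
  then show ?thesis
  proof cases
    case 1
    then have "J = {}" using finJ by simp
    then show ?thesis using sumJ schl_f_ge1[OF k] by simp
  next
    case 2
    then obtain j where "J = {j}" by (rule card_1_singletonE)
    then have "(\<Sum>j<k. norm (restr (F j) x)) \<le> 1 * norm x"
      using sumJ norm_restr_le by simp
    also have "\<dots> \<le> schl_f k * norm x" by (intro mult_right_mono schl_f_ge1 k) simp
    finally show ?thesis .
  next
    case 3
    obtain h where h: "bij_betw h {..<card J} J" and mono: "strict_mono_on {..<card J} h"
      by (rule ex_bij_betw_strict_mono_card[OF finJ(1)])
    have hJ: "h j \<in> J" if "j < card J" for j using h that by (auto simp: bij_betw_def)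
    have "successive (card J) (\<lambda>j. S (h j))"
      unfolding successive_def
    proof (intro conjI allI impI)
      fix j assume "j < card J"
      then show "finite (S (h j))" "S (h j) \<noteq> {}" using finS hJ[of j] by (auto simp: J_def)
    next
      fix j assume j: "Suc j < card J"
      then have "h j < h (Suc j)" using strict_mono_onD[OF mono, of j "Suc j"] by simp
      moreover have "h (Suc j) < k" "S (h j) \<noteq> {}" "S (h (Suc j)) \<noteq> {}"
        using hJ[of j] hJ[of "Suc j"] j by (auto simp: J_def)
      ultimately show "Max (S (h j)) < Min (S (h (Suc j)))"
        using ordered_setsD[OF F, of "h j" "h (Suc j)"] finS Max_in[of "S (h j)"]
          Min_in[of "S (h (Suc j))"] by (auto simp: S_def)
    qed
    then have "(\<Sum>j<card J. norm (restr (S (h j)) x)) \<le> schl_f (card J) * norm x"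
      by (rule successive_sum_le_norm[OF 3])
    also have "(\<Sum>j<card J. norm (restr (S (h j)) x)) = (\<Sum>j\<in>J. norm (restr (S j) x))"
      by (rule sum.reindex_bij_betw[OF h])
    finally show ?thesis using sumJ f by linarith
  qed
qed

text \<open>Successive sets pull back along a strictly increasing \<open>\<phi>\<close> to ordered sets, some of which may be
  empty. Hence the norm of a spread vector is estimated by that of the original one, and conversely,
  with the inverse of \<open>\<phi>\<close>.\<close>

lemma norm_spread_le:
  assumes mono: "strict_mono_on D \<phi>"
    and y: "\<And>i. i \<in> D \<Longrightarrow> coord y (\<phi> i) = coord x i" "\<And>j. j \<notin> \<phi> ` D \<Longrightarrow> coord y j = 0"
  shows "norm y \<le> norm x"
proof -
  let ?P = "\<lambda>E. {i \<in> D. \<phi> i \<in> E}"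
  have "norm (restr E y) \<le> norm (restr (?P E) x)" for E
  proof (rule norm_le_supersolution)
    fix E :: "nat set" and j assume j: "j \<in> E"
    show "\<bar>coord y j\<bar> \<le> norm (restr (?P E) x)"
    proof (cases "j \<in> \<phi> ` D")
      case True
      then obtain i where "i \<in> D" "j = \<phi> i" by blast
      then show ?thesis using j coord_le_norm[of "restr (?P E) x" i] y(1) by simp
    qed (simp add: y)
  next
    fix E :: "nat set" and k A assume k: "2 \<le> k" "successive k A"
      and le: "\<And>j. j < k \<Longrightarrow> norm (restr (E \<inter> A j) y) \<le> norm (restr (?P (E \<inter> A j)) x)"
    have ord: "ordered_sets k (\<lambda>j. ?P (E \<inter> A j))"
      unfolding ordered_sets_def
    proof (intro allI impI)
      fix i j a b assume h: "i < j" "j < k" "a \<in> ?P (E \<inter> A i)" "b \<in> ?P (E \<inter> A j)"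
      then have "\<phi> a < \<phi> b" using successive_less[OF k(2) h(1,2)] by blast
      then show "a < b" using h strict_mono_onD[OF mono, of b a]
        by (metis (mono_tags, lifting) linorder_less_linear mem_Collect_eq order_less_asym)
    qed
    have eq: "restr (?P (E \<inter> A j)) x = restr (?P (E \<inter> A j)) (restr (?P E) x)" for j
      by (rule c00_eqI) auto
    have "(\<Sum>j<k. norm (restr (E \<inter> A j) y)) \<le> (\<Sum>j<k. norm (restr (?P (E \<inter> A j)) x))"
      using le by (intro sum_mono) auto
    also have "\<dots> = (\<Sum>j<k. norm (restr (?P (E \<inter> A j)) (restr (?P E) x)))"
      by (simp only: eq[symmetric])
    also have "\<dots> \<le> schl_f k * norm (restr (?P E) x)"
      by (rule ordered_sum_le_norm[OF ord]) (use k in simp)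
    finally show "(\<Sum>j<k. norm (restr (E \<inter> A j) y)) \<le> schl_f k * norm (restr (?P E) x)" .
  qed simp
  from this[of UNIV] have "norm (restr UNIV y) \<le> norm x" using norm_restr_le order_trans by blast
  moreover have "restr UNIV y = y" by (rule c00_eqI) simp
  ultimately show ?thesis by simp
qed

lemma norm_spread:
  assumes mono: "strict_mono_on D \<phi>"
    and y: "\<And>i. i \<in> D \<Longrightarrow> coord y (\<phi> i) = coord x i" "\<And>j. j \<notin> \<phi> ` D \<Longrightarrow> coord y j = 0"
    and x: "\<And>i. i \<notin> D \<Longrightarrow> coord x i = 0"
  shows "norm y = norm x"
proof (rule antisym)
  show "norm y \<le> norm x" using norm_spread_le[OF mono y] .
  have inj: "inj_on \<phi> D" using mono by (rule strict_mono_on_imp_inj_on)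
  show "norm x \<le> norm y"
  proof (rule norm_spread_le[where D = "\<phi> ` D" and \<phi> = "inv_into D \<phi>"])
    show "strict_mono_on (\<phi> ` D) (inv_into D \<phi>)"
    proof (rule strict_mono_onI)
      fix a b assume "a \<in> \<phi> ` D" "b \<in> \<phi> ` D" "a < b"
      then obtain i j where "i \<in> D" "j \<in> D" "a = \<phi> i" "b = \<phi> j" "\<phi> i < \<phi> j" by blast
      then show "inv_into D \<phi> a < inv_into D \<phi> b"
        using inj strict_mono_onD[OF mono, of j i] by (metis inv_into_f_f linorder_less_linear order_less_asym)
    qed
  qed (use inj x y in \<open>auto simp: inv_into_f_f\<close>)
qed

section \<open>Power type upper estimates\<close>

text \<open>The concavity of \<open>t \<mapsto> t powr (1 - \<epsilon>)\<close>, in the form of Jensen's inequality for \<open>k\<close> summands.\<close>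

lemma sum_powr_le:
  fixes y :: "nat \<Rightarrow> real"
  assumes y: "\<And>j. j < k \<Longrightarrow> 0 \<le> y j" and \<epsilon>: "0 \<le> \<epsilon>" "\<epsilon> \<le> 1"
  shows "(\<Sum>j<k. y j powr (1 - \<epsilon>)) \<le> real k powr \<epsilon> * (\<Sum>j<k. y j) powr (1 - \<epsilon>)"
proof (cases "(\<Sum>j<k. y j) = 0")
  case True
  then have "y j = 0" if "j < k" for j
    using that y sum_nonneg_eq_0_iff[of "{..<k}" y] by auto
  then show ?thesis by simp
next
  case False
  define S where "S = (\<Sum>j<k. y j)"
  have "0 \<le> S" unfolding S_def by (rule sum_nonneg) (use y in auto)
  then have S: "0 < S" using False by (simp add: S_def)
  have k: "0 < real k" using False by (cases k) auto
  define Y where "Y = S / real k"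
  have Y: "0 < Y" using S k by (simp add: Y_def)
  have "y j powr (1 - \<epsilon>) * Y powr \<epsilon> \<le> (1 - \<epsilon>) * y j + \<epsilon> * Y" if "j < k" for j
  proof (cases "y j = 0")
    case True
    then show ?thesis using \<epsilon> Y by simp
  next
    case False
    then show ?thesis using y[OF that] Y \<epsilon> by (intro Youngs_inequality_0) auto
  qed
  then have "(\<Sum>j<k. y j powr (1 - \<epsilon>)) * Y powr \<epsilon> \<le> (\<Sum>j<k. (1 - \<epsilon>) * y j + \<epsilon> * Y)"
    unfolding sum_distrib_right by (intro sum_mono) auto
  also have "\<dots> = (1 - \<epsilon>) * S + \<epsilon> * (real k * Y)"
    by (simp add: sum.distrib sum_distrib_left[symmetric] S_def)
  also have "\<dots> = S" using k by (simp add: Y_def algebra_simps)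
  also have "S = real k powr \<epsilon> * S powr (1 - \<epsilon>) * Y powr \<epsilon>"
    using S k by (simp add: Y_def powr_divide powr_diff)
  finally show ?thesis unfolding S_def[symmetric] using Y by simp
qed

lemma exists_small_exponent:
  fixes K c \<epsilon>0 :: real
  assumes "1 \<le> K" "1 < c" "0 < \<epsilon>0"
  obtains \<epsilon> where "0 < \<epsilon>" "\<epsilon> \<le> \<epsilon>0" "K powr \<epsilon> \<le> c"
proof
  define \<epsilon> where "\<epsilon> = min \<epsilon>0 (ln c / (1 + ln K))"
  have l: "0 \<le> ln K" "0 < ln c" "0 < 1 + ln K" using assms by (auto intro: add_pos_nonneg)
  show "0 < \<epsilon>" "\<epsilon> \<le> \<epsilon>0" using assms l by (auto simp: \<epsilon>_def intro!: divide_pos_pos)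
  have "\<epsilon> * ln K \<le> ln c / (1 + ln K) * ln K" using l by (intro mult_right_mono) (auto simp: \<epsilon>_def)
  also have "\<dots> \<le> ln c" using l by (simp add: field_simps)
  finally have "exp (\<epsilon> * ln K) \<le> exp (ln c)" by simp
  then show "K powr \<epsilon> \<le> c" using assms by (simp add: powr_def)
qed

text \<open>With \<open>\<theta> = 1 - \<epsilon>\<close>, a bound by \<open>\<delta> * T E + T E powr \<theta>\<close> is a supersolution: an average over
  \<open>k \<le> K\<close> pieces gains a factor \<open>k powr (2 * \<epsilon>)\<close>, at most \<open>schl_f 2\<close>, by the concavity of the power.
  Averages over more than \<open>K\<close> pieces have to be estimated by other means; there the denominator
  \<open>schl_f k\<close> is large.\<close>

lemma norm_le_linear_plus_power:
  assumes \<epsilon>: "0 \<le> \<epsilon>" "\<epsilon> \<le> 1" and C: "0 \<le> C" and \<delta>: "0 \<le> \<delta>"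
    and K: "real K powr (2 * \<epsilon>) \<le> schl_f 2"
    and T: "\<And>E. 0 \<le> T E"
    and coord: "\<And>E i. i \<in> E \<Longrightarrow> \<bar>coord x i\<bar> \<le> C * T E powr (1 - \<epsilon>)"
    and few: "\<And>E k F. \<lbrakk>2 \<le> k; k \<le> K; ordered_sets k F; \<And>j. F j \<subseteq> E\<rbrakk> \<Longrightarrow>
      (\<Sum>j<k. T (F j)) \<le> real k powr \<epsilon> * T E"
    and many: "\<And>E k F. \<lbrakk>K < k; 2 \<le> k; ordered_sets k F; \<And>j. F j \<subseteq> E\<rbrakk> \<Longrightarrow>
      (\<Sum>j<k. norm (restr (F j) x)) \<le> schl_f k * (C * (\<delta> * T E + T E powr (1 - \<epsilon>)))"
  shows "norm (restr E x) \<le> C * (\<delta> * T E + T E powr (1 - \<epsilon>))"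
proof (rule norm_le_supersolution)
  fix E i assume "i \<in> (E :: nat set)"
  then have "\<bar>coord x i\<bar> \<le> C * T E powr (1 - \<epsilon>)" by (rule coord)
  also have "\<dots> \<le> C * (\<delta> * T E + T E powr (1 - \<epsilon>))"
    using C \<delta> T by (intro mult_left_mono) auto
  finally show "\<bar>coord x i\<bar> \<le> C * (\<delta> * T E + T E powr (1 - \<epsilon>))" .
next
  fix E
  show "0 \<le> C * (\<delta> * T E + T E powr (1 - \<epsilon>))" using C \<delta> T by auto
next
  fix E :: "nat set" and k D
  assume k: "2 \<le> k" "successive k D"
    and le: "\<And>j. j < k \<Longrightarrow> norm (restr (E \<inter> D j) x)
      \<le> C * (\<delta> * T (E \<inter> D j) + T (E \<inter> D j) powr (1 - \<epsilon>))"
  have ord: "ordered_sets k (\<lambda>j. E \<inter> D j)" using k(2) by (rule successive_ordered)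
  show "(\<Sum>j<k. norm (restr (E \<inter> D j) x)) \<le> schl_f k * (C * (\<delta> * T E + T E powr (1 - \<epsilon>)))"
  proof (cases "k \<le> K")
    case False
    then show ?thesis using k ord by (intro many) auto
  next
    case True
    define q where "q = real k powr \<epsilon>"
    have q1: "1 \<le> q" unfolding q_def using k \<epsilon> by (intro ge_one_powr_ge_zero) auto
    have qq: "q * q \<le> schl_f k"
    proof -
      have "q * q = real k powr (2 * \<epsilon>)" by (simp add: q_def powr_add[symmetric])
      also have "\<dots> \<le> real K powr (2 * \<epsilon>)" using True \<epsilon> by (intro powr_mono2) auto
      finally show ?thesis using K schl_f_mono[OF k(1)] by linarith
    qed
    have S: "(\<Sum>j<k. T (E \<inter> D j)) \<le> q * T E"
      unfolding q_def by (rule few) (use k True ord in auto)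
    have "q * T E \<le> (q * q) * T E" using q1 T by (intro mult_right_mono) auto
    then have S1: "(\<Sum>j<k. T (E \<inter> D j)) \<le> (q * q) * T E" using S by linarith
    have "(\<Sum>j<k. T (E \<inter> D j) powr (1 - \<epsilon>)) \<le> q * (\<Sum>j<k. T (E \<inter> D j)) powr (1 - \<epsilon>)"
      unfolding q_def using T \<epsilon> by (intro sum_powr_le) auto
    also have "\<dots> \<le> q * (q * T E) powr (1 - \<epsilon>)"
      using S T q1 \<epsilon> by (intro mult_left_mono powr_mono2) (auto intro!: sum_nonneg)
    also have "\<dots> = q * (q powr (1 - \<epsilon>) * T E powr (1 - \<epsilon>))"
      using q1 T by (simp add: powr_mult)
    also have "\<dots> \<le> q * (q powr 1 * T E powr (1 - \<epsilon>))"
      using q1 \<epsilon> by (intro mult_left_mono mult_right_mono powr_mono) auto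
    finally have S2: "(\<Sum>j<k. T (E \<inter> D j) powr (1 - \<epsilon>)) \<le> (q * q) * T E powr (1 - \<epsilon>)"
      using q1 by simp
    have "(\<Sum>j<k. norm (restr (E \<inter> D j) x))
        \<le> (\<Sum>j<k. C * (\<delta> * T (E \<inter> D j) + T (E \<inter> D j) powr (1 - \<epsilon>)))"
      using le by (intro sum_mono) auto
    also have "\<dots> = C * (\<delta> * (\<Sum>j<k. T (E \<inter> D j)) + (\<Sum>j<k. T (E \<inter> D j) powr (1 - \<epsilon>)))"
      by (simp only: sum_distrib_left[symmetric] sum.distrib)
    also have "\<dots> \<le> C * (\<delta> * ((q * q) * T E) + (q * q) * T E powr (1 - \<epsilon>))"
      using C \<delta> S1 S2 by (intro mult_left_mono add_mono) auto
    also have "\<dots> = (q * q) * (C * (\<delta> * T E + T E powr (1 - \<epsilon>)))" by (simp add: algebra_simps)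
    also have "\<dots> \<le> schl_f k * (C * (\<delta> * T E + T E powr (1 - \<epsilon>)))"
      using qq C \<delta> T by (intro mult_right_mono) auto
    finally show ?thesis .
  qed
qed

section \<open>Indicator vectors\<close>

lift_definition ind :: "nat set \<Rightarrow> c00" is "\<lambda>B i. if finite B \<and> i \<in> B then 1 else 0"
proof -
  fix B :: "nat set"
  show "finite {i. (if finite B \<and> i \<in> B then 1 else (0 :: real)) \<noteq> 0}" by (cases "finite B") auto
qed

lemma coord_ind: "finite B \<Longrightarrow> coord (ind B) i = (if i \<in> B then 1 else 0)"
  by transfer simp

lemma restr_ind: "finite B \<Longrightarrow> restr E (ind B) = ind (E \<inter> B)"
  by (rule c00_eqI) (simp add: coord_ind)

definition flat_norm :: "nat \<Rightarrow> real" where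
  "flat_norm n = norm (ind {..<n})"

lemma norm_ind:
  assumes "finite B"
  shows "norm (ind B) = flat_norm (card B)"
proof -
  obtain h where h: "bij_betw h {..<card B} B" "strict_mono_on {..<card B} h"
    by (rule ex_bij_betw_strict_mono_card[OF assms])
  show ?thesis unfolding flat_norm_def
    by (rule norm_spread[OF h(2)]) (use h(1) assms in \<open>auto simp: coord_ind bij_betw_def\<close>)
qed

lemma flat_norm_mono:
  assumes "m \<le> n" shows "flat_norm m \<le> flat_norm n"
proof -
  have "ind {..<m} = restr {..<m} (ind {..<n})" using assms by (simp add: restr_ind Int_absorb2)
  then show ?thesis unfolding flat_norm_def using norm_restr_le by simp
qed

lemma flat_norm_0 [simp]: "flat_norm 0 = 0"
proof -
  have "ind {} = 0" by (rule c00_eqI) (simp add: coord_ind)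
  then show ?thesis by (simp add: flat_norm_def)
qed

lemma flat_norm_ge1: "1 \<le> n \<Longrightarrow> 1 \<le> flat_norm n"
  unfolding flat_norm_def using coord_le_norm[of "ind {..<n}" 0] by (simp add: coord_ind)

lemma sum_card_ordered_le:
  assumes F: "ordered_sets k F" "\<And>j. j < k \<Longrightarrow> F j \<subseteq> E" and B: "finite B"
  shows "(\<Sum>j<k. card (F j \<inter> B)) \<le> card (E \<inter> B)"
proof -
  have "(\<Sum>j<k. card (F j \<inter> B)) = card (\<Union>j<k. F j \<inter> B)"
    using B ordered_sets_disjoint[OF F(1)] by (intro card_UN_disjoint[symmetric]) blast+
  also have "\<dots> \<le> card (E \<inter> B)" using F B by (intro card_mono) auto
  finally show ?thesis .
qed

lemma flat_norm_le: "flat_norm n \<le> real n"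
proof -
  have "norm (restr E (ind {..<n})) \<le> real (card (E \<inter> {..<n}))" for E
  proof (rule norm_le_supersolution)
    fix E and i :: nat assume "i \<in> E"
    then have "1 \<le> card (E \<inter> {..<n})" if "i < n" using that by (simp add: Suc_le_eq card_gt_0_iff) blast
    then show "\<bar>coord (ind {..<n}) i\<bar> \<le> real (card (E \<inter> {..<n}))" by (auto simp: coord_ind)
  next
    fix E :: "nat set" and k D
    assume k: "2 \<le> k" "successive k D"
      and le: "\<And>j. j < k \<Longrightarrow> norm (restr (E \<inter> D j) (ind {..<n})) \<le> real (card (E \<inter> D j \<inter> {..<n}))"
    have "(\<Sum>j<k. norm (restr (E \<inter> D j) (ind {..<n}))) \<le> (\<Sum>j<k. real (card (E \<inter> D j \<inter> {..<n})))"
      using le by (intro sum_mono) auto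
    also have "\<dots> = real (\<Sum>j<k. card (E \<inter> D j \<inter> {..<n}))" by simp
    also have "\<dots> \<le> real (card (E \<inter> {..<n}))"
      by (intro of_nat_mono sum_card_ordered_le successive_ordered k) auto
    also have "\<dots> \<le> schl_f k * real (card (E \<inter> {..<n}))"
      using schl_f_gt1[OF k(1)] by (simp add: mult_le_cancel_right1)
    finally show "(\<Sum>j<k. norm (restr (E \<inter> D j) (ind {..<n})))
      \<le> schl_f k * real (card (E \<inter> {..<n}))" .
  qed simp
  from this[of "{..<n}"] show ?thesis by (simp add: restr_ind flat_norm_def)
qed

lemma flat_norm_ge:
  assumes "1 \<le> n" shows "real n \<le> schl_f n * flat_norm n"
proof -
  have "(\<Sum>j<n. 1) \<le> (\<Sum>j<n. norm (restr {j} (ind {..<n})))"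
  proof (rule sum_mono)
    fix j assume "j \<in> {..<n}"
    then show "1 \<le> norm (restr {j} (ind {..<n}))"
      using coord_le_norm[of "restr {j} (ind {..<n})" j] by (simp add: coord_ind)
  qed
  also have "\<dots> \<le> schl_f n * norm (ind {..<n})"
    by (rule ordered_sum_le_norm) (use assms in \<open>auto simp: ordered_sets_def\<close>)
  finally show ?thesis by (simp add: flat_norm_def)
qed

text \<open>The number of elements is additive, so it can play the role of \<open>T\<close> in
  \<open>norm_le_linear_plus_power\<close>; for an average over many pieces the trivial bound \<open>flat_norm n \<le> n\<close>
  suffices, because \<open>schl_f\<close> is unbounded.\<close>

lemma flat_norm_sublinear:
  assumes "0 < \<eta>"
  obtains n where "1 \<le> n" "flat_norm n < \<eta> * real n"
proof -
  obtain K0 where K0: "2 / \<eta> \<le> schl_f K0" using schl_f_unbounded by blast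
  define K where "K = Suc K0"
  have K: "2 / \<eta> \<le> schl_f k" if "K < k" for k
    using K0 schl_f_mono[of K0 k] that by (simp add: K_def)
  obtain \<epsilon>' where \<epsilon>': "0 < \<epsilon>'" "\<epsilon>' \<le> 1" "real K powr \<epsilon>' \<le> schl_f 2"
    using exists_small_exponent[of "real K" "schl_f 2" 1] schl_f_gt1[of 2] by (auto simp: K_def)
  define \<epsilon> where "\<epsilon> = \<epsilon>' / 2"
  have \<epsilon>: "0 < \<epsilon>" "\<epsilon> \<le> 1" "real K powr (2 * \<epsilon>) \<le> schl_f 2" using \<epsilon>' by (auto simp: \<epsilon>_def)
  have bound: "flat_norm n \<le> \<eta> / 2 * real n + real n powr (1 - \<epsilon>)" for n
  proof -
    let ?T = "\<lambda>E. real (card (E \<inter> {..<n}))"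
    have le: "(\<Sum>j<k. ?T (F j)) \<le> ?T E" if F: "ordered_sets k F" "\<And>j. F j \<subseteq> E" for E k F
      using sum_card_ordered_le[OF F, where B = "{..<n}"] by (simp flip: of_nat_sum)
    have "norm (restr {..<n} (ind {..<n})) \<le> 1 * (\<eta> / 2 * ?T {..<n} + ?T {..<n} powr (1 - \<epsilon>))"
    proof (rule norm_le_linear_plus_power[where K = K and T = ?T])
      fix E and i :: nat assume i: "i \<in> E"
      show "\<bar>coord (ind {..<n}) i\<bar> \<le> 1 * ?T E powr (1 - \<epsilon>)"
      proof (cases "i < n")
        case True
        then have "1 \<le> card (E \<inter> {..<n})" using i by (simp add: Suc_le_eq card_gt_0_iff) blast
        then have "1 \<le> ?T E powr (1 - \<epsilon>)" using \<epsilon> by (intro ge_one_powr_ge_zero) auto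
        then show ?thesis by (simp add: coord_ind)
      qed (simp add: coord_ind)
    next
      fix E k F assume F: "2 \<le> k" "ordered_sets k F" "\<And>j. F j \<subseteq> (E :: nat set)"
      have "1 \<le> real k powr \<epsilon>" using F(1) \<epsilon> by (intro ge_one_powr_ge_zero) auto
      then show "(\<Sum>j<k. ?T (F j)) \<le> real k powr \<epsilon> * ?T E"
        using le[OF F(2,3)] mult_right_mono[of 1 "real k powr \<epsilon>" "?T E"] by simp
    next
      fix E k F assume F: "2 \<le> k" "ordered_sets k F" "\<And>j. F j \<subseteq> (E :: nat set)"
      assume "K < k"
      then have "1 \<le> schl_f k * (\<eta> / 2)" using K[of k] assms by (simp add: field_simps)
      then have "1 * ?T E \<le> (schl_f k * (\<eta> / 2)) * ?T E" by (intro mult_right_mono) auto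
      also have "\<dots> \<le> schl_f k * (1 * (\<eta> / 2 * ?T E + ?T E powr (1 - \<epsilon>)))"
        using schl_f_gt1[OF F(1)] by (simp add: algebra_simps)
      finally have "?T E \<le> schl_f k * (1 * (\<eta> / 2 * ?T E + ?T E powr (1 - \<epsilon>)))" by simp
      moreover have "norm (restr (F j) (ind {..<n})) \<le> ?T (F j)" for j
        using flat_norm_le by (simp add: restr_ind norm_ind)
      then have "(\<Sum>j<k. norm (restr (F j) (ind {..<n}))) \<le> (\<Sum>j<k. ?T (F j))"
        by (intro sum_mono) auto
      ultimately show "(\<Sum>j<k. norm (restr (F j) (ind {..<n})))
          \<le> schl_f k * (1 * (\<eta> / 2 * ?T E + ?T E powr (1 - \<epsilon>)))"
        using le[OF F(2,3)] by linarith
    qed (use \<epsilon> assms in auto)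
    then show ?thesis by (simp add: restr_ind flat_norm_def)
  qed
  obtain n where n: "(2 / \<eta>) powr (1 / \<epsilon>) < real n" using reals_Archimedean2 by blast
  then have n0: "0 < real n" using powr_ge_zero[of "2 / \<eta>" "1 / \<epsilon>"] by linarith
  have "((2 / \<eta>) powr (1 / \<epsilon>)) powr \<epsilon> < real n powr \<epsilon>"
    using \<epsilon> n by (intro powr_less_mono2) auto
  then have "2 / \<eta> < real n powr \<epsilon>" using \<epsilon> assms by (simp add: powr_powr)
  then have "2 / \<eta> * real n powr (1 - \<epsilon>) < real n powr \<epsilon> * real n powr (1 - \<epsilon>)"
    by (intro mult_strict_right_mono) (use n0 in auto)
  also have "\<dots> = real n" by (use n0 in \<open>simp add: powr_add[symmetric]\<close>)
  finally have "real n powr (1 - \<epsilon>) < \<eta> / 2 * real n" using assms by (simp add: field_simps)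
  then have "flat_norm n < \<eta> * real n" using bound[of n] by linarith
  then show thesis using n0 by (intro that) simp_all
qed

section \<open>Weakly null sequences of blocks\<close>

lemma ind_eq_sum: "finite B \<Longrightarrow> ind B = (\<Sum>b\<in>B. ind {b})"
proof (induction B rule: finite_induct)
  case empty
  show ?case by (rule c00_eqI) (simp add: coord_ind)
next
  case (insert b B)
  from insert(1,2) have "ind (insert b B) = ind {b} + ind B" by (intro c00_eqI) (auto simp: coord_ind)
  then show ?case using insert by simp
qed

lemma of_completion_sum: "of_completion (\<Sum>b\<in>B. u b) = (\<Sum>b\<in>B. of_completion (u b))"
  by (rule linear_sum[OF linear_of_completion])

text \<open>If a functional were at least \<open>\<eta>\<close> on infinitely many unit vectors, then it would be at least
  \<open>\<eta> * n\<close> on sums of \<open>n\<close> of them, while the norm of such a sum is \<open>o(n)\<close>.\<close>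

lemma weakly_null_unit_vectors: "weakly_null (\<lambda>n. of_completion (ind {n}))"
  unfolding weakly_null_def
proof (intro allI impI)
  fix \<phi> :: "schlumprecht \<Rightarrow> real" assume \<phi>: "bounded_linear \<phi>"
  have fin: "finite {n. \<eta> \<le> \<psi> (of_completion (ind {n}))}"
    if \<psi>: "bounded_linear \<psi>" and \<eta>: "0 < \<eta>" for \<psi> :: "schlumprecht \<Rightarrow> real" and \<eta>
  proof (rule ccontr)
    assume inf: "infinite {n. \<eta> \<le> \<psi> (of_completion (ind {n}))}"
    obtain K where K: "0 < K" "\<And>x. norm (\<psi> x) \<le> norm x * K"
      using bounded_linear.pos_bounded[OF \<psi>] by blast
    obtain n where n: "1 \<le> n" "flat_norm n < \<eta> / K * real n"
      using flat_norm_sublinear[of "\<eta> / K"] K(1) \<eta> by auto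
    obtain B where B: "B \<subseteq> {n. \<eta> \<le> \<psi> (of_completion (ind {n}))}" "finite B" "card B = n"
      using infinite_arbitrarily_large[OF inf] by blast
    have "\<eta> * real n = (\<Sum>b\<in>B. \<eta>)" using B by simp
    also have "\<dots> \<le> (\<Sum>b\<in>B. \<psi> (of_completion (ind {b})))" using B by (intro sum_mono) auto
    also have "\<dots> = \<psi> (of_completion (ind B))"
      by (simp add: ind_eq_sum[OF B(2)] of_completion_sum linear_sum[OF bounded_linear.linear[OF \<psi>]])
    also have "\<dots> \<le> flat_norm n * K"
      using K(2)[of "of_completion (ind B)"] B by (simp add: norm_of_completion norm_ind)
    finally show False using n(2) K(1) by (simp add: field_simps)
  qed
  show "(\<lambda>n. \<phi> (of_completion (ind {n}))) \<longlonglongrightarrow> 0"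
  proof (rule tendstoI)
    fix e :: real assume e: "0 < e"
    have "finite ({n. e \<le> \<phi> (of_completion (ind {n}))} \<union> {n. e \<le> - \<phi> (of_completion (ind {n}))})"
      using fin[OF \<phi> e] fin[OF bounded_linear_minus[OF \<phi>] e] by simp
    then have "\<forall>\<^sub>F n in cofinite. \<not> (e \<le> \<phi> (of_completion (ind {n})) \<or> e \<le> - \<phi> (of_completion (ind {n})))"
      unfolding eventually_cofinite by (simp add: Un_def)
    then show "\<forall>\<^sub>F n in sequentially. dist (\<phi> (of_completion (ind {n}))) 0 < e"
      unfolding cofinite_eq_sequentially by eventually_elim (auto simp: abs_if)
  qed
qed

definition flat :: "nat \<Rightarrow> nat \<Rightarrow> c00" where
  "flat l n = (1 / flat_norm l) *\<^sub>R ind {n..<n + l}"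

lemma normalized_flat: "1 \<le> l \<Longrightarrow> normalized (\<lambda>n. of_completion (flat l n))"
  using flat_norm_ge1[of l]
  by (simp add: normalized_def norm_of_completion flat_def norm_ind)

lemma weakly_null_flat: "weakly_null (\<lambda>n. of_completion (flat l n))"
  unfolding weakly_null_def
proof (intro allI impI)
  fix \<phi> :: "schlumprecht \<Rightarrow> real" assume \<phi>: "bounded_linear \<phi>"
  have unit: "(\<lambda>n. \<phi> (of_completion (ind {n}))) \<longlonglongrightarrow> 0"
    using weakly_null_unit_vectors \<phi> by (simp add: weakly_null_def)
  have "ind {n..<n + l} = (\<Sum>t<l. ind {n + t})" for n
    unfolding ind_eq_sum[OF finite_atLeastLessThan]
    by (rule sum.reindex_bij_witness[of _ "\<lambda>t. n + t" "\<lambda>b. b - n"]) auto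
  then have eq: "\<phi> (of_completion (flat l n)) = 1 / flat_norm l * (\<Sum>t<l. \<phi> (of_completion (ind {n + t})))" for n
    by (simp add: flat_def linear_scale[OF linear_of_completion] of_completion_sum
        linear_scale[OF bounded_linear.linear[OF \<phi>]] linear_sum[OF bounded_linear.linear[OF \<phi>]])
  have "(\<lambda>n. 1 / flat_norm l * (\<Sum>t<l. \<phi> (of_completion (ind {n + t})))) \<longlonglongrightarrow> 1 / flat_norm l * (\<Sum>t<l. 0)"
    by (intro tendsto_intros LIMSEQ_ignore_initial_segment unit)
  then show "(\<lambda>n. \<phi> (of_completion (flat l n))) \<longlonglongrightarrow> 0" by (simp add: eq)
qed

section \<open>Iterated limits of sums of blocks\<close>

lemma coord_sum: "coord (\<Sum>i\<in>A. u i) q = (\<Sum>i\<in>A. coord (u i) q)"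
  by (induction A rule: infinite_finite_induct) auto

lemma coord_flat: "coord (flat l n) q = (if q \<in> {n..<n + l} then 1 / flat_norm l else 0)"
  by (simp add: flat_def coord_ind)

lemma norm_sum_flat_spread:
  assumes mono: "strict_mono_on D \<psi>"
    and blocks: "\<And>i. i \<in> I \<Longrightarrow> {p i..<p i + l i} \<subseteq> D"
      "\<And>i. i \<in> I \<Longrightarrow> \<psi> ` {p i..<p i + l i} = {p' i..<p' i + l i}"
  shows "norm (\<Sum>i\<in>I. flat (l i) (p' i)) = norm (\<Sum>i\<in>I. flat (l i) (p i))"
proof (rule norm_spread[OF mono])
  have inj: "inj_on \<psi> D" using mono by (rule strict_mono_on_imp_inj_on)
  fix a assume a: "a \<in> D"
  have "\<psi> a \<in> {p' i..<p' i + l i} \<longleftrightarrow> a \<in> {p i..<p i + l i}" if "i \<in> I" for i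
    using inj_on_image_mem_iff[OF inj a blocks(1)[OF that]] blocks(2)[OF that] by simp
  then show "coord (\<Sum>i\<in>I. flat (l i) (p' i)) (\<psi> a) = coord (\<Sum>i\<in>I. flat (l i) (p i)) a"
    unfolding coord_sum coord_flat by (intro sum.cong) auto
next
  fix j assume j: "j \<notin> \<psi> ` D"
  have "j \<notin> {p' i..<p' i + l i}" if "i \<in> I" for i
    using j blocks[OF that] by blast
  then show "coord (\<Sum>i\<in>I. flat (l i) (p' i)) j = 0"
    unfolding coord_sum coord_flat by (intro sum.neutral) auto
next
  fix a assume a: "a \<notin> D"
  then have "a \<notin> {p i..<p i + l i}" if "i \<in> I" for i
    using blocks(1)[OF that] by blast
  then show "coord (\<Sum>i\<in>I. flat (l i) (p i)) a = 0"
    unfolding coord_sum coord_flat by (intro sum.neutral) auto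
qed

text \<open>The recursion runs parallel to that of \<open>has_iterated_lim\<close>: \<open>D\<close> collects the blocks whose
  position is already fixed, and the next index is so large that its block lies behind \<open>D\<close>.\<close>

primrec follows :: "(nat \<Rightarrow> nat) \<Rightarrow> (nat \<Rightarrow> nat) \<Rightarrow> nat set \<Rightarrow> nat list \<Rightarrow> bool" where
  "follows l p D [] \<longleftrightarrow> True"
| "follows l p D (i # is) \<longleftrightarrow>
     (\<forall>a\<in>D. a < p i) \<and> follows l p (D \<union> {p i..<p i + l i}) is"

text \<open>Two placements in the same order differ only by an increasing map of the coordinates.\<close>

lemma follows_spread:
  assumes "follows l p D is" "follows l p' (\<phi> ` D) is" "strict_mono_on D \<phi>"
  shows "\<exists>\<psi>. strict_mono_on (D \<union> (\<Union>i\<in>set is. {p i..<p i + l i})) \<psi> \<and> (\<forall>a\<in>D. \<psi> a = \<phi> a) \<and>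
    (\<forall>i\<in>set is. \<psi> ` {p i..<p i + l i} = {p' i..<p' i + l i})"
  using assms
proof (induction "is" arbitrary: D \<phi>)
  case Nil
  then show ?case by auto
next
  case (Cons i "is")
  let ?D = "D \<union> {p i..<p i + l i}"
  define \<xi> where "\<xi> a = (if a < p i then \<phi> a else p' i + (a - p i))" for a
  have below: "a < p i" "\<phi> a < p' i" if "a \<in> D" for a using Cons.prems that by auto
  have eqD: "\<xi> a = \<phi> a" if "a \<in> D" for a using below[OF that] by (simp add: \<xi>_def)
  have eqB: "\<xi> ` {p i..<p i + l i} = {p' i..<p' i + l i}"
  proof (intro equalityI subsetI)
    fix b assume "b \<in> {p' i..<p' i + l i}"
    then show "b \<in> \<xi> ` {p i..<p i + l i}"
      by (intro image_eqI[of _ _ "p i + (b - p' i)"]) (auto simp: \<xi>_def)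
  qed (auto simp: \<xi>_def)
  have "strict_mono_on ?D \<xi>"
  proof (rule strict_mono_onI)
    fix a b assume ab: "a \<in> ?D" "b \<in> ?D" "a < b"
    show "\<xi> a < \<xi> b"
    proof (cases "b \<in> D")
      case True
      then have "a \<in> D" using ab below[of b] by auto
      then show ?thesis using True ab strict_mono_onD[OF Cons.prems(3)] by (simp add: eqD)
    next
      case False
      then have b: "p i \<le> b" using ab by auto
      show ?thesis
      proof (cases "a \<in> D")
        case True
        then show ?thesis using below(2)[OF True] b eqD[OF True] by (simp add: \<xi>_def)
      qed (use ab b in \<open>auto simp: \<xi>_def\<close>)
    qed
  qed
  moreover have "\<xi> ` ?D = \<phi> ` D \<union> {p' i..<p' i + l i}"
    unfolding image_Un eqB using eqD by auto
  ultimately obtain \<psi> where \<psi>: "strict_mono_on (?D \<union> (\<Union>i\<in>set is. {p i..<p i + l i})) \<psi>"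
    "\<forall>a\<in>?D. \<psi> a = \<xi> a" "\<forall>i\<in>set is. \<psi> ` {p i..<p i + l i} = {p' i..<p' i + l i}"
    using Cons.IH[of ?D \<xi>] Cons.prems(1,2) by auto
  have "\<psi> ` {p i..<p i + l i} = {p' i..<p' i + l i}"
    unfolding eqB[symmetric] using \<psi>(2) by (intro image_cong) auto
  then show ?case using \<psi> eqD by (intro exI[of _ \<psi>]) (auto simp: Un_assoc)
qed

lemma follows_ordered:
  assumes "follows l p D is"
  shows "ordered_sets (length is) (\<lambda>a. {p (is ! a)..<p (is ! a) + l (is ! a)})"
proof -
  have "(\<forall>b < length is. \<forall>q\<in>D. q < p (is ! b)) \<and>
    (\<forall>b < length is. \<forall>a < b. \<forall>q\<in>{p (is ! a)..<p (is ! a) + l (is ! a)}. q < p (is ! b))"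
    using assms
  proof (induction "is" arbitrary: D)
    case (Cons i "is")
    from Cons.IH[of "D \<union> {p i..<p i + l i}"] Cons.prems
    have IH: "\<And>b q. b < length is \<Longrightarrow> q \<in> D \<union> {p i..<p i + l i} \<Longrightarrow> q < p (is ! b)"
      "\<And>a b q. b < length is \<Longrightarrow> a < b \<Longrightarrow> q \<in> {p (is ! a)..<p (is ! a) + l (is ! a)} \<Longrightarrow> q < p (is ! b)"
      by auto
    show ?case
    proof (intro conjI allI impI ballI)
      fix b q assume "b < length (i # is)" "q \<in> D"
      then show "q < p ((i # is) ! b)" using IH(1) Cons.prems by (cases b) auto
    next
      fix b a q assume "b < length (i # is)" "a < b"
        "q \<in> {p ((i # is) ! a)..<p ((i # is) ! a) + l ((i # is) ! a)}"
      then show "q < p ((i # is) ! b)" using IH by (cases b; cases a) auto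
    qed
  qed simp
  then show ?thesis unfolding ordered_sets_def by (meson atLeastLessThan_iff order_less_le_trans)
qed

lemma exists_follows:
  assumes "finite D" "distinct is"
  shows "\<exists>p. (\<forall>j. j \<notin> set is \<longrightarrow> p j = n j) \<and> follows l p D is"
  using assms
proof (induction "is" arbitrary: D n)
  case Nil
  then show ?case by auto
next
  case (Cons i "is")
  obtain k where k: "\<forall>a\<in>D. a < k" using Cons.prems(1) finite_nat_set_iff_bounded by blast
  obtain p where p: "\<forall>j. j \<notin> set is \<longrightarrow> p j = (n(i := k)) j" "follows l p (D \<union> {k..<k + l i}) is"
    using Cons.IH[of "D \<union> {k..<k + l i}" "n(i := k)"] Cons.prems by auto
  have "p i = k" using p(1) Cons.prems by auto
  then show ?case using p k by (intro exI[of _ p]) auto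
qed

text \<open>The iterated limit is attained: once the blocks follow one another in the prescribed order,
  the norm of their sum no longer depends on the distances between them.\<close>

lemma has_iterated_lim_flat:
  fixes m :: nat and l :: "nat \<Rightarrow> nat"
  defines "F \<equiv> \<lambda>n. norm (\<Sum>i<m. flat (l i) (n i))"
  assumes "distinct is" "set is \<subseteq> {..<m}" "\<And>j. j \<notin> set is \<Longrightarrow> p j = n j"
    "follows l p (\<Union>j\<in>{..<m} - set is. {n j..<n j + l j}) is"
  shows "has_iterated_lim is F n (F p)"
  using assms(2-)
proof (induction "is" arbitrary: n p)
  case Nil
  then have "p = n" by auto
  then show ?case by simp
next
  case (Cons i "is")
  let ?D = "\<lambda>is n. \<Union>j\<in>{..<m} - set is. {n j..<n j + l j}"
  have fin: "finite (?D xs n)" for xs and n :: "nat \<Rightarrow> nat" by simp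
  have "\<exists>q. (\<forall>j. j \<notin> set is \<longrightarrow> q j = (n(i := k)) j) \<and> follows l q (?D is (n(i := k))) is" for k
    by (rule exists_follows) (use Cons.prems in auto)
  then obtain q where q: "\<And>k j. j \<notin> set is \<Longrightarrow> q k j = (n(i := k)) j"
    "\<And>k. follows l (q k) (?D is (n(i := k))) is" by metis
  have lim: "has_iterated_lim is F (n(i := k)) (F (q k))" for k
    by (rule Cons.IH) (use Cons.prems q in auto)
  obtain b where b: "\<forall>a\<in>?D (i # is) n. a < b" using fin finite_nat_set_iff_bounded by blast
  have const: "F (q k) = F p" if k: "b \<le> k" for k
  proof -
    have qi: "q k i = k" using q(1)[of i k] Cons.prems by simp
    have "?D is (n(i := k)) = ?D (i # is) n \<union> {k..<k + l i}"
    proof -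
      have A: "{..<m} - set is = insert i ({..<m} - set (i # is))" using Cons.prems(1,2) by auto
      have "?D (i # is) (n(i := k)) = ?D (i # is) n" by (intro SUP_cong refl) auto
      then show ?thesis unfolding A UN_insert by (simp add: Un_commute)
    qed
    then have fol: "follows l (q k) (?D (i # is) n) (i # is)"
      unfolding follows.simps qi using q(2)[of k] b k by (metis order_less_le_trans)
    \<comment> \<open>The blocks outside the list keep their position, so the spreading map starts as the identity.\<close>
    from Cons.prems(4) have "follows l p ((\<lambda>a. a) ` ?D (i # is) n) (i # is)" by simp
    from follows_spread[OF fol this] obtain \<psi> where
      \<psi>: "strict_mono_on (?D (i # is) n \<union> (\<Union>j\<in>set (i # is). {q k j..<q k j + l j})) \<psi>"
      "\<forall>a\<in>?D (i # is) n. \<psi> a = a"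
      "\<forall>j\<in>set (i # is). \<psi> ` {q k j..<q k j + l j} = {p j..<p j + l j}"
      by (auto simp: strict_mono_on_def)
    have fixed: "q k j = n j" "p j = n j" if "j \<notin> set (i # is)" for j
      using q(1)[of j k] Cons.prems(3)[of j] that by auto
    have "F p = F (q k)" unfolding F_def
    proof (rule norm_sum_flat_spread[OF \<psi>(1)])
      fix j assume j: "j \<in> {..<m}"
      show "{q k j..<q k j + l j} \<subseteq> ?D (i # is) n \<union> (\<Union>j\<in>set (i # is). {q k j..<q k j + l j})"
      proof (cases "j \<in> set (i # is)")
        case False
        then show ?thesis using fixed[OF False] j by auto
      qed blast
      show "\<psi> ` {q k j..<q k j + l j} = {p j..<p j + l j}"
      proof (cases "j \<in> set (i # is)")
        case True
        then show ?thesis using \<psi>(3) by blast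
      next
        case False
        then have "\<psi> ` {n j..<n j + l j} = (\<lambda>a. a) ` {n j..<n j + l j}"
          using \<psi>(2) j by (intro image_cong refl) blast
        then show ?thesis using fixed[OF False] by simp
      qed
    qed
    then show ?thesis by simp
  qed
  have "(\<lambda>k. F (q k)) \<longlonglongrightarrow> F p"
    by (rule tendsto_eventually) (use const in \<open>auto simp: eventually_sequentially\<close>)
  then show ?case using lim
    unfolding has_iterated_lim.simps by (intro exI[of _ "\<lambda>k. F (q k)"] conjI allI)
qed

section \<open>Blocks with good upper estimates\<close>

lemma flat_norm_add_le: "flat_norm (m + n) \<le> flat_norm m + flat_norm n"
proof -
  have "ind {..<m + n} = ind {..<m} + ind {m..<m + n}"
    by (rule c00_eqI) (auto simp: coord_ind)
  then have "flat_norm (m + n) \<le> norm (ind {..<m}) + norm (ind {m..<m + n})"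
    unfolding flat_norm_def by (simp add: norm_triangle_ineq)
  then show ?thesis by (simp add: norm_ind)
qed

lemma flat_norm_mult_le: "flat_norm (s * n) \<le> real s * flat_norm n"
proof (induction s)
  case (Suc s)
  then show ?case using flat_norm_add_le[of n "s * n"] by (simp add: algebra_simps)
qed simp

text \<open>Since \<open>flat_norm n\<close> is at least \<open>n / schl_f n\<close>, the quotient \<open>flat_norm n / n powr (1 - \<epsilon>)\<close> is
  unbounded and attains new maxima at arbitrarily large \<open>n\<close>. Such a record controls \<open>flat_norm\<close> at all
  smaller lengths, without an exact formula for it.\<close>

lemma exists_record:
  assumes "0 < \<epsilon>" "1 \<le> s"
  obtains M where "s \<le> M"
    "\<And>p. p \<le> M \<Longrightarrow> flat_norm p \<le> (real p / real M) powr (1 - \<epsilon>) * flat_norm M"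
proof -
  define a where "a n = flat_norm n / real n powr (1 - \<epsilon>)" for n
  define c where "c = Max (a ` {..s})"
  have "filterlim (\<lambda>x::real. x powr \<epsilon> / log 2 (x + 1)) at_top at_top"
    using assms(1) by real_asymp
  then have "filterlim (\<lambda>n. real n powr \<epsilon> / log 2 (real n + 1)) at_top sequentially"
    by (rule filterlim_compose[OF _ filterlim_real_sequentially])
  then have "\<forall>\<^sub>F n in sequentially. c < real n powr \<epsilon> / log 2 (real n + 1)"
    by (simp add: filterlim_at_top_dense)
  then obtain Q where Q: "s \<le> Q" "c < real Q powr \<epsilon> / schl_f Q"
    unfolding schl_f_def eventually_sequentially by (meson le_cases order_refl)
  have Q1: "1 \<le> Q" using Q assms by simp
  have "real Q powr \<epsilon> / schl_f Q = real Q / schl_f Q / real Q powr (1 - \<epsilon>)"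
    using Q1 by (simp add: powr_diff)
  also have "\<dots> \<le> a Q" unfolding a_def
    using flat_norm_ge[OF Q1] schl_f_ge1[OF Q1] by (intro divide_right_mono) (auto simp: field_simps)
  finally have cQ: "c < a Q" using Q by simp
  have "finite (a ` {1..Q})" "a ` {1..Q} \<noteq> {}" using Q1 by auto
  from Max_in[OF this] obtain M where M: "M \<in> {1..Q}" "a M = Max (a ` {1..Q})" by auto
  have max: "a p \<le> a M" if "p \<in> {1..Q}" for p using that unfolding M(2) by (intro Max_ge) auto
  show thesis
  proof (rule that)
    show "s \<le> M"
    proof (rule ccontr)
      assume "\<not> s \<le> M"
      then have "a M \<le> c" unfolding c_def by (intro Max_ge) auto
      then show False using cQ max[of Q] Q1 by simp
    qed
    fix p assume p: "p \<le> M"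
    show "flat_norm p \<le> (real p / real M) powr (1 - \<epsilon>) * flat_norm M"
    proof (cases "p = 0")
      case False
      then have "a p \<le> a M" using p M by (intro max) auto
      then show ?thesis using False M unfolding a_def by (simp add: powr_divide field_simps)
    qed simp
  qed
qed

text \<open>The next type of blocks, given a threshold \<open>N\<close> which exceeds all data of the previous types. The
  exponent \<open>\<epsilon>\<close> is so close to \<open>0\<close> that splitting a block into at most \<open>N\<close> pieces increases the upper
  estimate for its norm by at most a factor \<open>2\<close>. For more than \<open>N'\<close> pieces the denominator in the implicit
  equation exceeds \<open>r\<close> times the \<open>\<ell>\<^sub>1\<close> norm of the block. The length is chosen such that \<open>s\<close> blocks make
  up a record length, up to rounding; then comparison with the record yields both the upper
  estimate for parts of one block and the lower estimate for \<open>s\<close> adjacent blocks.\<close>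

lemma exists_block_length:
  assumes s: "2 \<le> s" and "0 < \<epsilon>0" "1 \<le> N"
  shows "\<exists>\<epsilon> n N'. 0 < \<epsilon> \<and> \<epsilon> \<le> \<epsilon>0 \<and> real N powr \<epsilon> \<le> 2 \<and> 1 \<le> n \<and> N \<le> N' \<and>
    real r * real n \<le> schl_f N' \<and>
    (\<forall>p\<le>n. flat_norm p \<le> 4 * (real p / real n) powr (1 - \<epsilon>) * flat_norm n) \<and>
    real s / 4 * flat_norm n \<le> flat_norm (s * n)"
proof -
  obtain \<epsilon> where \<epsilon>: "0 < \<epsilon>" "\<epsilon> \<le> min \<epsilon>0 1" "real (max N s) powr \<epsilon> \<le> 2"
    by (rule exists_small_exponent[of "real (max N s)" 2 "min \<epsilon>0 1"]) (use assms in auto)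
  have N2: "real N powr \<epsilon> \<le> 2" "real s powr \<epsilon> \<le> 2"
    using \<epsilon> powr_mono2[of \<epsilon> "real N" "real (max N s)"] powr_mono2[of \<epsilon> "real s" "real (max N s)"]
    by auto
  obtain M where M: "s \<le> M"
    "\<And>p. p \<le> M \<Longrightarrow> flat_norm p \<le> (real p / real M) powr (1 - \<epsilon>) * flat_norm M"
    by (rule exists_record[of \<epsilon> s]) (use \<epsilon> s in auto)
  define n where "n = M div s + 1"
  have n1: "1 \<le> n" by (simp add: n_def)
  have snM: "M \<le> s * n" unfolding n_def using s
    by (metis Suc_eq_plus1 dividend_less_times_div less_imp_le mult_Suc_right add.commute not_numeral_le_zero zero_less_iff_neq_zero)
  have nM: "n \<le> M"
  proof -
    have "M div s \<le> M div 2" using s by (intro div_le_mono2) auto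
    then show ?thesis using s M(1) unfolding n_def by linarith
  qed
  have "real n * real s \<le> 2 * real M"
  proof -
    have "M div s * s \<le> M" by simp
    moreover have "n * s = M div s * s + s" by (simp add: n_def)
    ultimately have "n * s \<le> 2 * M" using M(1) by linarith
    then show ?thesis by (metis of_nat_le_iff of_nat_mult of_nat_numeral)
  qed
  then have ratio: "real n / real M \<le> 2 / real s" using s M by (simp add: field_simps)
  have "(real n / real M) powr (1 - \<epsilon>) \<le> (2 / real s) powr (1 - \<epsilon>)"
    using ratio \<epsilon> by (intro powr_mono2) auto
  also have "\<dots> = 2 / real s * (real s / 2) powr \<epsilon>"
    using s by (simp add: powr_diff powr_divide)
  also have "\<dots> \<le> 2 / real s * 2"
  proof (rule mult_left_mono)
    have "(real s / 2) powr \<epsilon> \<le> real s powr \<epsilon>" using \<epsilon> s by (intro powr_mono2) auto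
    then show "(real s / 2) powr \<epsilon> \<le> 2" using N2 by simp
  qed simp
  finally have R: "(real n / real M) powr (1 - \<epsilon>) \<le> 4 / real s" by simp
  have Msn: "flat_norm M \<le> flat_norm (s * n)" using snM by (rule flat_norm_mono)
  have pos: "0 \<le> flat_norm k" for k by (simp add: flat_norm_def)
  have lower: "real s / 4 * flat_norm n \<le> flat_norm (s * n)"
  proof -
    have "flat_norm n \<le> (real n / real M) powr (1 - \<epsilon>) * flat_norm M" by (rule M(2)[OF nM])
    also have "\<dots> \<le> 4 / real s * flat_norm (s * n)"
      using R Msn pos by (intro mult_mono) auto
    finally show ?thesis using s by (simp add: field_simps)
  qed
  have upper: "flat_norm p \<le> 4 * (real p / real n) powr (1 - \<epsilon>) * flat_norm n" if "p \<le> n" for p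
  proof -
    have "flat_norm p \<le> (real p / real M) powr (1 - \<epsilon>) * flat_norm M"
      using that nM by (intro M(2)) auto
    also have "real p / real M = (real p / real n) * (real n / real M)" using n1 by simp
    also have "(\<dots>) powr (1 - \<epsilon>) = (real p / real n) powr (1 - \<epsilon>) * (real n / real M) powr (1 - \<epsilon>)"
      by (rule powr_mult)
    also have "\<dots> * flat_norm M
        \<le> ((real p / real n) powr (1 - \<epsilon>) * (4 / real s)) * (real s * flat_norm n)"
      using R Msn flat_norm_mult_le[of s n] pos
      by (intro mult_mono mult_left_mono) auto
    also have "\<dots> = 4 * (real p / real n) powr (1 - \<epsilon>) * flat_norm n" using s by simp
    finally show ?thesis .
  qed
  obtain N0 where N0: "real r * real n \<le> schl_f N0" using schl_f_unbounded by blast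
  have "real r * real n \<le> schl_f (max N N0)" using N0 schl_f_mono[of N0 "max N N0"] by simp
  then show ?thesis using \<epsilon> N2 n1 upper lower
    by (intro exI[of _ \<epsilon>] exI[of _ n] exI[of _ "max N N0"]) auto
qed

section \<open>Grouped and cyclic arrangements\<close>

lemma coord_sum_blocks:
  assumes B: "ordered_sets m B" "\<And>a. a < m \<Longrightarrow> finite (B a)"
  shows "a < m \<Longrightarrow> q \<in> B a \<Longrightarrow> coord (\<Sum>a<m. c a *\<^sub>R ind (B a)) q = c a"
    and "(\<And>a. a < m \<Longrightarrow> q \<notin> B a) \<Longrightarrow> coord (\<Sum>a<m. c a *\<^sub>R ind (B a)) q = 0"
proof -
  assume a: "a < m" "q \<in> B a"
  have "coord (\<Sum>a<m. c a *\<^sub>R ind (B a)) q = (\<Sum>b<m. if b = a then c a else 0)"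
    unfolding coord_sum
  proof (intro sum.cong refl)
    fix b assume b: "b \<in> {..<m}"
    then have "q \<notin> B b" if "b \<noteq> a" using ordered_sets_disjoint[OF B(1), of a b] a that by auto
    then show "coord (c b *\<^sub>R ind (B b)) q = (if b = a then c a else 0)"
      using a b B(2) by (auto simp: coord_ind)
  qed
  then show "coord (\<Sum>a<m. c a *\<^sub>R ind (B a)) q = c a" using a by simp
next
  assume "\<And>a. a < m \<Longrightarrow> q \<notin> B a"
  then show "coord (\<Sum>a<m. c a *\<^sub>R ind (B a)) q = 0"
    unfolding coord_sum using B(2) by (intro sum.neutral) (auto simp: coord_ind)
qed

text \<open>The \<open>s\<close> adjacent blocks of type \<open>g\<close> together are a flat vector of length \<open>s * n g\<close>. The \<open>r\<close> groups
  are used as pieces in the implicit equation.\<close>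

lemma grouped_norm_ge:
  assumes B: "ordered_sets (r * s) B" "\<And>a. a < r * s \<Longrightarrow> finite (B a)"
      "\<And>a. a < r * s \<Longrightarrow> card (B a) = n (a div s)"
    and r: "1 \<le> r" and s: "1 \<le> s" and n: "\<And>i. 1 \<le> n i"
    and lower: "\<And>i. real s / 4 * flat_norm (n i) \<le> flat_norm (s * n i)"
  shows "real r * real s / 4 \<le> schl_f r * norm (\<Sum>a<r * s. (1 / flat_norm (n (a div s))) *\<^sub>R ind (B a))"
proof -
  define x where "x = (\<Sum>a<r * s. (1 / flat_norm (n (a div s))) *\<^sub>R ind (B a))"
  define F where "F g = (\<Union>a\<in>{g * s..<(g + 1) * s}. B a)" for g
  have idx: "a div s = g" "a < r * s" if "a \<in> {g * s..<(g + 1) * s}" "g < r" for a g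
  proof -
    show "a div s = g" using that by (intro div_nat_eqI) (auto simp: mult.commute)
    have "(g + 1) * s \<le> r * s" using that by (intro mult_right_mono) auto
    then show "a < r * s" using that by simp
  qed
  have ordF: "ordered_sets r F"
    unfolding ordered_sets_def
  proof (intro allI impI)
    fix g h p q assume gh: "g < h" "h < r" and p: "p \<in> F g" and q: "q \<in> F h"
    obtain a b where a: "a \<in> {g * s..<(g + 1) * s}" "p \<in> B a"
      and b: "b \<in> {h * s..<(h + 1) * s}" "q \<in> B b" using p q by (auto simp: F_def)
    have "(g + 1) * s \<le> h * s" using gh by (intro mult_right_mono) auto
    then have "a < b" using a b by simp
    then show "p < q" using ordered_setsD[OF B(1) _ idx(2)[OF b(1) gh(2)] a(2) b(2)] by simp
  qed
  have piece: "real s / 4 \<le> norm (restr (F g) x)" if g: "g < r" for g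
  proof -
    have finF: "finite (F g)" unfolding F_def using B(2) idx(2) g by (intro finite_UN_I) auto
    have "card (F g) = (\<Sum>a\<in>{g * s..<(g + 1) * s}. card (B a))"
      unfolding F_def
    proof (rule card_UN_disjoint)
      show "\<forall>a\<in>{g * s..<(g + 1) * s}. finite (B a)" using B(2) idx(2) g by blast
      show "\<forall>a\<in>{g * s..<(g + 1) * s}. \<forall>b\<in>{g * s..<(g + 1) * s}. a \<noteq> b \<longrightarrow> B a \<inter> B b = {}"
        using ordered_sets_disjoint[OF B(1)] idx(2) g by blast
    qed simp
    also have "\<dots> = (\<Sum>a\<in>{g * s..<(g + 1) * s}. n g)"
      using B(3) idx g by (intro sum.cong) auto
    finally have cardF: "card (F g) = s * n g" by simp
    have "restr (F g) x = (1 / flat_norm (n g)) *\<^sub>R ind (F g)"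
    proof (rule c00_eqI)
      fix q
      show "coord (restr (F g) x) q = coord ((1 / flat_norm (n g)) *\<^sub>R ind (F g)) q"
      proof (cases "q \<in> F g")
        case True
        then obtain a where a: "a \<in> {g * s..<(g + 1) * s}" "q \<in> B a" by (auto simp: F_def)
        have "coord x q = 1 / flat_norm (n (a div s))"
          unfolding x_def by (rule coord_sum_blocks(1)) (use B idx[OF a(1) g] a in auto)
        then show ?thesis using True idx[OF a(1) g] finF by (simp add: coord_ind)
      qed (simp add: finF coord_ind)
    qed
    then have "norm (restr (F g) x) = flat_norm (s * n g) / flat_norm (n g)"
      using flat_norm_ge1[OF n, of g] by (simp add: norm_ind finF cardF)
    moreover have "real s / 4 \<le> flat_norm (s * n g) / flat_norm (n g)"
      using lower[of g] flat_norm_ge1[OF n, of g] by (subst pos_le_divide_eq) auto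
    ultimately show ?thesis by simp
  qed
  have "real r * real s / 4 = (\<Sum>g<r. real s / 4)" by simp
  also have "\<dots> \<le> (\<Sum>g<r. norm (restr (F g) x))" using piece by (intro sum_mono) auto
  also have "\<dots> \<le> schl_f r * norm x" by (rule ordered_sum_le_norm[OF ordF r])
  finally show ?thesis by (simp add: x_def)
qed

text \<open>Arbitrary sets of coordinates may contain blocks of one type only. Measuring a set by its interval
  hull restores the balance between the types, and hulls of ordered sets are again ordered.\<close>

definition interval_hull :: "nat set \<Rightarrow> nat set" where
  "interval_hull E = {q. \<exists>a\<in>E. \<exists>b\<in>E. a \<le> q \<and> q \<le> b}"

lemma subset_interval_hull: "E \<subseteq> interval_hull E"
  by (auto simp: interval_hull_def)

lemma interval_hull_mono: "E \<subseteq> F \<Longrightarrow> interval_hull E \<subseteq> interval_hull F"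
  by (auto simp: interval_hull_def)

lemma interval_hull_between: "a \<in> interval_hull E \<Longrightarrow> b \<in> interval_hull E \<Longrightarrow> a \<le> q \<Longrightarrow> q \<le> b \<Longrightarrow> q \<in> interval_hull E"
  unfolding interval_hull_def by (blast intro: order_trans)

lemma ordered_sets_interval_hull: "ordered_sets k F \<Longrightarrow> ordered_sets k (\<lambda>j. interval_hull (F j))"
  unfolding ordered_sets_def
proof (intro allI impI)
  fix i j p q
  assume F: "\<forall>i j a b. i < j \<longrightarrow> j < k \<longrightarrow> a \<in> F i \<longrightarrow> b \<in> F j \<longrightarrow> a < b"
    and ij: "i < j" "j < k" and "p \<in> interval_hull (F i)" "q \<in> interval_hull (F j)"
  then obtain a b where "p \<le> a" "a \<in> F i" "b \<in> F j" "b \<le> q" unfolding interval_hull_def by blast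
  moreover from this have "a < b" using F ij by blast
  ultimately show "p < q" by linarith
qed

lemma card_residue_class_le:
  fixes p0 p1 r i :: nat
  assumes r: "1 \<le> r" and le: "p0 \<le> p1"
  shows "real (card {a \<in> {p0..p1}. a mod r = i}) \<le> (real p1 - real p0) / real r + 2"
proof -
  let ?A = "{a \<in> {p0..p1}. a mod r = i}"
  have "inj_on (\<lambda>a. a div r) ?A"
    by (rule inj_onI) (metis (mono_tags, lifting) div_mult_mod_eq mem_Collect_eq)
  then have "card ?A = card ((\<lambda>a. a div r) ` ?A)" by (simp add: card_image)
  also have "\<dots> \<le> card {p0 div r..p1 div r}"
    by (intro card_mono) (auto intro: div_le_mono)
  finally have "real (card ?A) \<le> real (p1 div r) + 1 - real (p0 div r)"
    using div_le_mono[OF le, of r] by simp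
  moreover have "real (p1 div r) \<le> real p1 / real r" by (rule of_nat_div_le_of_nat)
  moreover have "real p0 / real r - 1 \<le> real (p0 div r)"
  proof -
    have "p0 \<le> r * (p0 div r) + r" using r mult_div_mod_eq[of r p0] mod_less_divisor[of r p0] by linarith
    then have "real p0 \<le> real r * real (p0 div r) + real r" by (metis of_nat_add of_nat_le_iff of_nat_mult)
    then show ?thesis using r by (simp add: field_simps)
  qed
  ultimately show ?thesis by (simp add: diff_divide_distrib)
qed

text \<open>A supersolution in terms of the number \<open>T E\<close> of blocks that meet the interval hull of \<open>E\<close>, where a
  block of type \<open>i\<close> of which a fraction \<open>t\<close> is covered counts as \<open>t powr (1 - e i)\<close>. With this power
  the contribution of a block dominates the norm of its covered part, and it is almost additive
  when the block is split into not too many pieces.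

  For averages over \<open>k > thr 0\<close> pieces, the position of \<open>k\<close> among the thresholds decides which
  estimate applies to a block of type \<open>i\<close>: for \<open>thr (Suc i) \<le> k\<close> the \<open>\<ell>\<^sub>1\<close> norm is small in comparison
  with \<open>schl_f k\<close>; for \<open>k \<le> thr i\<close> splitting gains at most a factor \<open>2\<close>, while \<open>schl_f k \<ge> r\<close>; only
  one type remains, for which the implicit equation gives no gain. In a cyclic arrangement
  this type accounts for at most the fraction \<open>1 / r\<close> of the blocks in an interval, up to a bounded
  number of blocks, which the power \<open>T E powr (1 - \<epsilon>)\<close> absorbs.\<close>

lemma cyclic_norm_le:
  fixes n thr :: "nat \<Rightarrow> nat" and e :: "nat \<Rightarrow> real"
  assumes r: "1 \<le> r" and \<epsilon>: "0 < \<epsilon>" "\<epsilon> \<le> 1"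
    and K: "real r \<le> schl_f (thr 0)" "real (thr 0) powr (2 * \<epsilon>) \<le> schl_f 2"
    and thr: "\<And>i. thr i \<le> thr (Suc i)"
    and e: "\<And>i. 0 \<le> e i" "\<And>i. e i \<le> \<epsilon>" "\<And>i. real (thr i) powr e i \<le> 2"
    and n: "\<And>i. 1 \<le> n i" "\<And>i. real r * real (n i) \<le> schl_f (thr (Suc i))"
    and upper: "\<And>i p. p \<le> n i \<Longrightarrow>
      flat_norm p \<le> 4 * (real p / real (n i)) powr (1 - e i) * flat_norm (n i)"
    and B: "ordered_sets (r * s) B" "\<And>a. a < r * s \<Longrightarrow> finite (B a)"
      "\<And>a. a < r * s \<Longrightarrow> card (B a) = n (a mod r)"
  shows "norm (\<Sum>a<r * s. (1 / flat_norm (n (a mod r))) *\<^sub>R ind (B a))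
    \<le> 12 * (real s + (real r * real s) powr (1 - \<epsilon>))"
proof -
  define v where "v a = (1 / flat_norm (n (a mod r))) *\<^sub>R ind (B a)" for a
  define x where "x = (\<Sum>a<r * s. v a)"
  define \<tau> where "\<tau> a E = (real (card (interval_hull E \<inter> B a)) / real (n (a mod r))) powr (1 - e (a mod r))" for a E
  define T where "T E = (\<Sum>a<r * s. \<tau> a E)" for E
  have e1: "e i \<le> 1" for i using e(2)[of i] \<epsilon> by simp
  have \<tau>0: "0 \<le> \<tau> a E" for a E by (simp add: \<tau>_def)
  have T0: "0 \<le> T E" for E unfolding T_def by (intro sum_nonneg \<tau>0)
  have \<tau>T: "\<tau> a E \<le> T E" if "a < r * s" for a E
    unfolding T_def using that \<tau>0 by (intro member_le_sum) auto
  have An: "1 \<le> flat_norm (n i)" for i by (rule flat_norm_ge1[OF n(1)])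
  have thr_mono: "thr i \<le> thr j" if "i \<le> j" for i j
    using that thr by (rule lift_Suc_mono_le[rotated])
  have frac: "0 \<le> real (card (interval_hull E \<inter> B a)) / real (n (a mod r))"
    "real (card (interval_hull E \<inter> B a)) / real (n (a mod r)) \<le> 1" if "a < r * s" for a E
    using card_mono[OF B(2)[OF that], of "interval_hull E \<inter> B a"] B(3)[OF that] n(1)[of "a mod r"] by auto
  have norm_v: "norm (restr E (v a)) = flat_norm (card (E \<inter> B a)) / flat_norm (n (a mod r))"
    if "a < r * s" for a E
  proof -
    have "restr E (v a) = (1 / flat_norm (n (a mod r))) *\<^sub>R ind (E \<inter> B a)"
      using B(2)[OF that] by (intro c00_eqI) (simp add: v_def coord_ind)
    then show ?thesis using An[of "a mod r"] B(2)[OF that] by (simp add: norm_ind)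
  qed
  have v_le: "norm (restr E (v a)) \<le> 4 * \<tau> a E" if a: "a < r * s" for a E
  proof -
    have "card (E \<inter> B a) \<le> card (interval_hull E \<inter> B a)"
      using subset_interval_hull[of E] B(2)[OF a] by (intro card_mono) auto
    then have "flat_norm (card (E \<inter> B a)) \<le> flat_norm (card (interval_hull E \<inter> B a))" by (rule flat_norm_mono)
    also have "\<dots> \<le> 4 * \<tau> a E * flat_norm (n (a mod r))"
      unfolding \<tau>_def using card_mono[OF B(2)[OF a], of "interval_hull E \<inter> B a"] B(3)[OF a]
      by (intro upper) auto
    finally show ?thesis unfolding norm_v[OF a] using An[of "a mod r"] by (simp add: pos_divide_le_eq)
  qed
  have small: "(\<Sum>j<k. norm (restr (F j) (v a))) \<le> schl_f k * (1 / real r * \<tau> a E)"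
    if a: "a < r * s" and k: "thr (Suc (a mod r)) \<le> k" and F: "ordered_sets k F" "\<And>j. F j \<subseteq> E" for a k F E
  proof -
    let ?n = "n (a mod r)"
    have le: "norm (restr (F j) (v a)) \<le> real (card (F j \<inter> B a))" for j
    proof -
      have "flat_norm (card (F j \<inter> B a)) / flat_norm ?n \<le> flat_norm (card (F j \<inter> B a)) / 1"
        using An[of "a mod r"] by (intro divide_left_mono) (auto simp: flat_norm_def)
      then show ?thesis unfolding norm_v[OF a] using flat_norm_le[of "card (F j \<inter> B a)"] by simp
    qed
    have "(\<Sum>j<k. norm (restr (F j) (v a))) \<le> real (\<Sum>j<k. card (F j \<inter> B a))"
      unfolding of_nat_sum by (intro sum_mono le)
    also have "\<dots> \<le> real (card (E \<inter> B a))"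
      by (intro of_nat_mono sum_card_ordered_le F B(2)[OF a])
    also have "\<dots> \<le> real (card (interval_hull E \<inter> B a))"
      using subset_interval_hull[of E] B(2)[OF a] by (intro of_nat_mono card_mono) auto
    also have "\<dots> = real ?n * (real (card (interval_hull E \<inter> B a)) / real ?n)" using n(1)[of "a mod r"] by simp
    also have "\<dots> \<le> real ?n * \<tau> a E"
    proof (rule mult_left_mono)
      have "(real (card (interval_hull E \<inter> B a)) / real ?n) powr 1 \<le> \<tau> a E"
        unfolding \<tau>_def using frac[OF a] e(1) by (intro powr_mono') auto
      then show "real (card (interval_hull E \<inter> B a)) / real ?n \<le> \<tau> a E" using frac(1)[OF a] by simp
    qed simp
    also have "\<dots> \<le> (schl_f k / real r) * \<tau> a E"
    proof (rule mult_right_mono[OF _ \<tau>0])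
      have "real r * real ?n \<le> schl_f k" using n(2)[of "a mod r"] schl_f_mono[OF k] by linarith
      then show "real ?n \<le> schl_f k / real r" using r by (simp add: field_simps)
    qed
    finally show ?thesis by simp
  qed
  have split: "(\<Sum>j<k. \<tau> a (F j)) \<le> real k powr e (a mod r) * \<tau> a E"
    if a: "a < r * s" and F: "ordered_sets k F" "\<And>j. F j \<subseteq> E" for a k F E
  proof -
    let ?n = "n (a mod r)" and ?e = "e (a mod r)"
    have "(\<Sum>j<k. \<tau> a (F j)) \<le> real k powr ?e * (\<Sum>j<k. real (card (interval_hull (F j) \<inter> B a)) / real ?n) powr (1 - ?e)"
      unfolding \<tau>_def using frac[OF a] e(1) e1 by (intro sum_powr_le) auto
    also have "\<dots> \<le> real k powr ?e * \<tau> a E"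
      unfolding \<tau>_def
    proof (intro mult_left_mono powr_mono2)
      have "(\<Sum>j<k. card (interval_hull (F j) \<inter> B a)) \<le> card (interval_hull E \<inter> B a)"
        by (intro sum_card_ordered_le ordered_sets_interval_hull F interval_hull_mono B(2)[OF a])
      then have "(\<Sum>j<k. real (card (interval_hull (F j) \<inter> B a))) \<le> real (card (interval_hull E \<inter> B a))"
        by (simp flip: of_nat_sum)
      then show "(\<Sum>j<k. real (card (interval_hull (F j) \<inter> B a)) / real ?n) \<le> real (card (interval_hull E \<inter> B a)) / real ?n"
        unfolding sum_divide_distrib[symmetric] by (intro divide_right_mono) auto
    qed (use e1 frac[OF a] in \<open>auto intro!: sum_nonneg\<close>)
    finally show ?thesis .
  qed
  have large: "(\<Sum>j<k. norm (restr (F j) (v a))) \<le> schl_f k * (8 / real r * \<tau> a E)"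
    if a: "a < r * s" and k: "thr 0 < k" "k \<le> thr (a mod r)"
      and F: "ordered_sets k F" "\<And>j. F j \<subseteq> E" for a k F E
  proof -
    have "real k powr e (a mod r) \<le> real (thr (a mod r)) powr e (a mod r)"
      using k e(1) by (intro powr_mono2) auto
    then have k2: "real k powr e (a mod r) \<le> 2" using e(3)[of "a mod r"] by linarith
    have "real r \<le> schl_f k" using K(1) schl_f_mono[of "thr 0" k] k by linarith
    then have fk: "1 \<le> schl_f k / real r" using r by (simp add: field_simps)
    have "(\<Sum>j<k. norm (restr (F j) (v a))) \<le> (\<Sum>j<k. 4 * \<tau> a (F j))" by (intro sum_mono v_le a)
    also have "\<dots> = 4 * (\<Sum>j<k. \<tau> a (F j))" by (simp add: sum_distrib_left)
    also have "\<dots> \<le> 4 * (real k powr e (a mod r) * \<tau> a E)" using split[OF a F] by simp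
    also have "\<dots> \<le> 4 * (2 * \<tau> a E)" using k2 \<tau>0 by (intro mult_left_mono mult_right_mono) auto
    also have "\<dots> \<le> (schl_f k / real r) * (4 * (2 * \<tau> a E))"
      using fk \<tau>0[of a E] mult_right_mono[of 1 "schl_f k / real r" "4 * (2 * \<tau> a E)"] by simp
    finally show ?thesis by (simp add: algebra_simps)
  qed
  have middle: "(\<Sum>j<k. norm (restr (F j) (v a))) \<le> schl_f k * (4 * \<tau> a E)"
    if a: "a < r * s" and k: "2 \<le> k" and F: "ordered_sets k F" "\<And>j. F j \<subseteq> E" for a k F E
  proof -
    have eq: "restr (F j) (restr E (v a)) = restr (F j) (v a)" for j
      using F(2)[of j] by (intro c00_eqI) auto
    have "(\<Sum>j<k. norm (restr (F j) (restr E (v a)))) \<le> schl_f k * norm (restr E (v a))"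
      by (rule ordered_sum_le_norm[OF F(1)]) (use k in simp)
    also have "\<dots> \<le> schl_f k * (4 * \<tau> a E)"
      using schl_f_gt1[OF k] v_le[OF a] by (intro mult_left_mono) auto
    finally show ?thesis by (simp only: eq)
  qed
  \<comment> \<open>All blocks strictly between the first and the last one that the hull meets are covered
    completely, so \<open>T E\<close> is at least their number.\<close>
  have residue: "(\<Sum>a | a < r * s \<and> a mod r = i. \<tau> a E) \<le> 1 / real r * T E + 3 * T E powr (1 - \<epsilon>)" for i E
  proof (cases "T E \<le> 1")
    case True
    have "(\<Sum>a | a < r * s \<and> a mod r = i. \<tau> a E) \<le> T E"
      unfolding T_def using \<tau>0 by (intro sum_mono2) auto
    also have "T E = T E powr 1" using T0 by simp
    also have "\<dots> \<le> T E powr (1 - \<epsilon>)" using True T0 \<epsilon> by (intro powr_mono') auto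
    finally have "(\<Sum>a | a < r * s \<and> a mod r = i. \<tau> a E) \<le> T E powr (1 - \<epsilon>)" .
    moreover have "0 \<le> 1 / real r * T E" "0 \<le> T E powr (1 - \<epsilon>)" using T0 by auto
    ultimately show ?thesis by linarith
  next
    case False
    define Q where "Q = {a. a < r * s \<and> interval_hull E \<inter> B a \<noteq> {}}"
    have finQ: "finite Q" by (simp add: Q_def)
    have \<tau>Q: "\<tau> a E = 0" if "a \<notin> Q" "a < r * s" for a using that by (simp add: \<tau>_def Q_def)
    have "Q \<noteq> {}"
    proof
      assume "Q = {}"
      then have "T E = 0" unfolding T_def using \<tau>Q by (intro sum.neutral) auto
      then show False using False by simp
    qed
    define p0 where "p0 = Min Q"
    define p1 where "p1 = Max Q"
    have p: "p0 \<in> Q" "p1 \<in> Q" "Q \<subseteq> {p0..p1}"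
      using finQ \<open>Q \<noteq> {}\<close> by (auto simp: p0_def p1_def)
    have le: "p0 \<le> p1" using p by auto
    have p1rs: "p1 < r * s" using p by (simp add: Q_def)
    have "B a \<subseteq> interval_hull E" if a: "p0 < a" "a < p1" for a
    proof
      fix q assume q: "q \<in> B a"
      obtain y z where "y \<in> interval_hull E" "y \<in> B p0" "z \<in> interval_hull E" "z \<in> B p1"
        using p(1,2) by (auto simp: Q_def)
      moreover have "y < q" using ordered_setsD[OF B(1), of p0 a y q] a p1rs q calculation by simp
      moreover have "q < z" using ordered_setsD[OF B(1), of a p1 q z] a p1rs q calculation by simp
      ultimately show "q \<in> interval_hull E" using interval_hull_between[of y E z q] by simp
    qed
    then have \<tau>1: "\<tau> a E = 1" if "a \<in> {p0<..<p1}" for a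
      using that B(3)[of a] n(1)[of "a mod r"] p1rs by (simp add: \<tau>_def Int_absorb1)
    have "real p1 - real p0 - 1 \<le> (\<Sum>a\<in>{p0<..<p1}. \<tau> a E)" by (simp add: \<tau>1 of_nat_diff)
    also have "\<dots> \<le> T E" unfolding T_def using \<tau>0 p1rs by (intro sum_mono2) auto
    finally have len: "real p1 - real p0 - 1 \<le> T E" .
    have "(\<Sum>a | a < r * s \<and> a mod r = i. \<tau> a E) = (\<Sum>a | a \<in> Q \<and> a mod r = i. \<tau> a E)"
      using \<tau>Q by (intro sum.mono_neutral_right) (auto simp: Q_def)
    also have "\<dots> \<le> (\<Sum>a | a \<in> Q \<and> a mod r = i. 1)"
    proof (rule sum_mono)
      fix a assume "a \<in> {a \<in> Q. a mod r = i}"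
      then have "a < r * s" by (simp add: Q_def)
      then show "\<tau> a E \<le> 1" unfolding \<tau>_def using frac[of a E] e1 by (intro powr_le1) auto
    qed
    also have "\<dots> = real (card {a \<in> Q. a mod r = i})" by simp
    also have "\<dots> \<le> real (card {a \<in> {p0..p1}. a mod r = i})"
      using p(3) by (intro of_nat_mono card_mono) auto
    also have "\<dots> \<le> (real p1 - real p0) / real r + 2" by (rule card_residue_class_le[OF r le])
    also have "\<dots> \<le> (T E + 1) / real r + 2" using len by (intro add_mono divide_right_mono) auto
    also have "\<dots> \<le> T E / real r + 3" using r by (simp add: add_divide_distrib)
    also have "\<dots> \<le> 1 / real r * T E + 3 * T E powr (1 - \<epsilon>)"
      using False \<epsilon> ge_one_powr_ge_zero[of "T E" "1 - \<epsilon>"] by simp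
    finally show ?thesis .
  qed
  have "norm (restr UNIV x) \<le> 12 * (1 / real r * T UNIV + T UNIV powr (1 - \<epsilon>))"
  proof (rule norm_le_linear_plus_power[where K = "thr 0" and T = T])
    fix E :: "nat set" and q assume q: "q \<in> E"
    show "\<bar>coord x q\<bar> \<le> 12 * T E powr (1 - \<epsilon>)"
    proof (cases "\<exists>a<r * s. q \<in> B a")
      case False
      then have "coord x q = 0"
        unfolding x_def v_def by (intro coord_sum_blocks(2) B) auto
      then show ?thesis by simp
    next
      case True
      then obtain a where a: "a < r * s" "q \<in> B a" by blast
      have cx: "coord x q = 1 / flat_norm (n (a mod r))"
        unfolding x_def v_def by (rule coord_sum_blocks(1)[OF B(1,2) a])
      then have le1: "\<bar>coord x q\<bar> \<le> 1" using An[of "a mod r"] by simp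
      have "coord x q = coord (restr E (v a)) q"
        using cx a q B(2) by (simp add: v_def coord_ind)
      then have "\<bar>coord x q\<bar> \<le> 4 * \<tau> a E"
        using coord_le_norm[of "restr E (v a)" q] v_le[OF a(1), of E] by simp
      then have le4: "\<bar>coord x q\<bar> \<le> 4 * T E" using \<tau>T[OF a(1), of E] by linarith
      show ?thesis
      proof (cases "T E \<le> 1")
        case True
        then have "T E powr 1 \<le> T E powr (1 - \<epsilon>)" using T0 \<epsilon> by (intro powr_mono') auto
        then show ?thesis using le4 T0[of E] by simp
      next
        case False
        then show ?thesis using le1 \<epsilon> ge_one_powr_ge_zero[of "T E" "1 - \<epsilon>"] by simp
      qed
    qed
  next
    fix E :: "nat set" and k F
    assume k: "2 \<le> k" and F: "ordered_sets k F" "\<And>j. F j \<subseteq> E"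
    have "(\<Sum>j<k. T (F j)) = (\<Sum>a<r * s. \<Sum>j<k. \<tau> a (F j))" unfolding T_def by (rule sum.swap)
    also have "\<dots> \<le> (\<Sum>a<r * s. real k powr \<epsilon> * \<tau> a E)"
    proof (rule sum_mono)
      fix a assume "a \<in> {..<r * s}"
      then have "(\<Sum>j<k. \<tau> a (F j)) \<le> real k powr e (a mod r) * \<tau> a E" using split F by blast
      also have "\<dots> \<le> real k powr \<epsilon> * \<tau> a E"
        using k e(2) \<tau>0 by (intro mult_right_mono powr_mono) auto
      finally show "(\<Sum>j<k. \<tau> a (F j)) \<le> real k powr \<epsilon> * \<tau> a E" .
    qed
    finally show "(\<Sum>j<k. T (F j)) \<le> real k powr \<epsilon> * T E" by (simp add: T_def sum_distrib_left)
  next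
    fix E :: "nat set" and k F
    assume k: "thr 0 < k" "2 \<le> k" and F: "ordered_sets k F" "\<And>j. F j \<subseteq> E"
    \<comment> \<open>The exceptional type, with \<open>thr i0 \<le> k < thr (Suc i0)\<close>. If \<open>k\<close> exceeds all thresholds of types
      that occur, the value of \<open>i0\<close> does not matter.\<close>
    define i0 where "i0 = (LEAST i. k < thr (Suc i))"
    have each: "(\<Sum>j<k. norm (restr (F j) (v a)))
        \<le> schl_f k * (8 / real r * \<tau> a E + (if a mod r = i0 then 4 * \<tau> a E else 0))"
      if a: "a < r * s" for a
    proof -
      have f: "0 \<le> schl_f k" using schl_f_gt1[OF k(2)] by simp
      consider "thr (Suc (a mod r)) \<le> k" | "k < thr (Suc (a mod r))" "a mod r = i0"
        | "k < thr (Suc (a mod r))" "a mod r \<noteq> i0" by linarith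
      then show ?thesis
      proof cases
        case 1
        then have "(\<Sum>j<k. norm (restr (F j) (v a))) \<le> schl_f k * (1 / real r * \<tau> a E)"
          using small[OF a _ F] by simp
        also have "\<dots> \<le> schl_f k * (8 / real r * \<tau> a E + (if a mod r = i0 then 4 * \<tau> a E else 0))"
          using f \<tau>0[of a E] by (intro mult_left_mono add_increasing2 mult_right_mono divide_right_mono) auto
        finally show ?thesis .
      next
        case 2
        have "schl_f k * (4 * \<tau> a E) \<le> schl_f k * (8 / real r * \<tau> a E + 4 * \<tau> a E)"
          using f \<tau>0[of a E] by (intro mult_left_mono) auto
        then show ?thesis using middle[OF a k(2) F] 2(2) by simp
      next
        case 3
        have "k < thr (Suc i0)" "i0 \<le> a mod r"
          unfolding i0_def using 3(1) by (auto intro: LeastI Least_le)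
        then have "k \<le> thr (a mod r)" using 3(2) thr_mono[of "Suc i0" "a mod r"] by simp
        then show ?thesis using large[OF a k(1) _ F] 3(2) by simp
      qed
    qed
    have lin: "restr A x = (\<Sum>a<r * s. restr A (v a))" for A
      by (rule c00_eqI) (simp add: x_def coord_sum)
    have "(\<Sum>j<k. norm (restr (F j) x)) \<le> (\<Sum>j<k. \<Sum>a<r * s. norm (restr (F j) (v a)))"
      unfolding lin by (intro sum_mono norm_sum)
    also have "\<dots> = (\<Sum>a<r * s. \<Sum>j<k. norm (restr (F j) (v a)))" by (rule sum.swap)
    also have "\<dots> \<le> (\<Sum>a<r * s. schl_f k * (8 / real r * \<tau> a E + (if a mod r = i0 then 4 * \<tau> a E else 0)))"
      using each by (intro sum_mono) auto
    also have "\<dots> = schl_f k * (8 / real r * T E + 4 * (\<Sum>a | a < r * s \<and> a mod r = i0. \<tau> a E))"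
    proof -
      have "(\<Sum>a<r * s. if a mod r = i0 then 4 * \<tau> a E else 0)
          = (\<Sum>a | a < r * s \<and> a mod r = i0. 4 * \<tau> a E)"
        by (simp add: sum.inter_filter[symmetric])
      then show ?thesis unfolding T_def
        by (simp only: sum_distrib_left[symmetric] sum.distrib)
    qed
    also have "\<dots> \<le> schl_f k * (8 / real r * T E + 4 * (1 / real r * T E + 3 * T E powr (1 - \<epsilon>)))"
      using schl_f_gt1[OF k(2)] residue[of E i0] by (intro mult_left_mono add_left_mono) linarith+
    also have "\<dots> = schl_f k * (12 * (1 / real r * T E + T E powr (1 - \<epsilon>)))"
      by (simp add: algebra_simps)
    finally show "(\<Sum>j<k. norm (restr (F j) x))
        \<le> schl_f k * (12 * (1 / real r * T E + T E powr (1 - \<epsilon>)))" .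
  qed (use \<epsilon> K T0 in auto)
  moreover have "restr UNIV x = x" by (rule c00_eqI) simp
  ultimately have "norm x \<le> 12 * (1 / real r * T UNIV + T UNIV powr (1 - \<epsilon>))" by simp
  also have "\<dots> \<le> 12 * (real s + (real r * real s) powr (1 - \<epsilon>))"
  proof (intro mult_left_mono add_mono)
    have "T UNIV \<le> (\<Sum>a<r * s. 1)" unfolding T_def
    proof (rule sum_mono)
      fix a assume "a \<in> {..<r * s}"
      then show "\<tau> a UNIV \<le> 1" unfolding \<tau>_def using frac[of a UNIV] e1 by (intro powr_le1) auto
    qed
    then have T_UNIV: "T UNIV \<le> real r * real s" by simp
    show "1 / real r * T UNIV \<le> real s" using T_UNIV r by (simp add: field_simps)
    show "T UNIV powr (1 - \<epsilon>) \<le> (real r * real s) powr (1 - \<epsilon>)"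
      using T_UNIV T0 \<epsilon> by (intro powr_mono2) auto
  qed simp
  finally show ?thesis by (simp add: x_def v_def)
qed

section \<open>Failure of asymptotic symmetry\<close>

lemma ordered_sets_cong:
  "ordered_sets k F \<Longrightarrow> (\<And>j. j < k \<Longrightarrow> F j = G j) \<Longrightarrow> ordered_sets k G"
  unfolding ordered_sets_def by (metis order_less_trans)

text \<open>If \<open>{..<r * s}\<close> is read as an array, this permutation is its transposition. In the grouped
  arrangement the index \<open>b\<close> has type \<open>b div s\<close>, so the rearranged types are \<open>a mod r\<close>.\<close>

lemma transposition_permutes:
  fixes r s :: nat
  shows "(\<lambda>a. if a < r * s then (a mod r) * s + a div r else a) permutes {..<r * s}" (is "?\<sigma> permutes _")
    and "a < r * s \<Longrightarrow> ((a mod r) * s + a div r) div s = a mod r"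
proof -
  have lt: "(a mod v) * w + a div v < v * w" "a div v < w"
    "((a mod v) * w + a div v) div w = a mod v" "((a mod v) * w + a div v) mod w = a div v"
    if a: "a < v * w" for a v w :: nat
  proof -
    have v: "0 < v" "0 < w" using a by (auto intro: gr0I)
    show d: "a div v < w" using a v by (simp add: less_mult_imp_div_less mult.commute)
    have "a mod v + 1 \<le> v" using v by (simp add: Suc_le_eq)
    then have "(a mod v + 1) * w \<le> v * w" by (rule mult_right_mono) simp
    then show "(a mod v) * w + a div v < v * w" using d by simp
    show "((a mod v) * w + a div v) div w = a mod v" "((a mod v) * w + a div v) mod w = a div v"
      using d v by auto
  qed
  show "a < r * s \<Longrightarrow> ((a mod r) * s + a div r) div s = a mod r" using lt(3) by blast
  have "bij_betw ?\<sigma> {..<r * s} {..<r * s}"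
  proof (rule bij_betw_byWitness[where f' = "\<lambda>a. (a mod s) * r + a div s"])
    show "\<forall>a\<in>{..<r * s}. (?\<sigma> a mod s) * r + ?\<sigma> a div s = a" using lt(3,4)[of _ r s] by simp
    show "\<forall>a\<in>{..<r * s}. ?\<sigma> ((a mod s) * r + a div s) = a"
      using lt(1,3,4)[of _ s r] by (simp add: mult.commute[of r s])
    show "?\<sigma> ` {..<r * s} \<subseteq> {..<r * s}" using lt(1)[of _ r s] by auto
    show "(\<lambda>a. (a mod s) * r + a div s) ` {..<r * s} \<subseteq> {..<r * s}"
      using lt(1)[of _ s r] by (auto simp: mult.commute[of r s])
  qed
  then show "?\<sigma> permutes {..<r * s}" by (rule bij_imp_permutes) simp
qed

text \<open>The parameters: \<open>thr 0 = 2 ^ r\<close> makes \<open>schl_f (thr 0) \<ge> r\<close>; then \<open>\<epsilon> = 1 / (4 * r)\<close> gives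
  \<open>thr 0 powr (2 * \<epsilon>) = sqrt 2\<close>, which is at most \<open>schl_f 2 = log 2 3\<close>; finally \<open>s = r ^ (4 * r)\<close> gives
  \<open>(r * s) powr (1 - \<epsilon>) \<le> s\<close>. The given order of the sequences is the grouped one, and the permutation
  rearranges them cyclically.\<close>

lemma not_wnas_witness:
  fixes r :: nat
  assumes r: "2 \<le> r"
  obtains x :: "nat \<Rightarrow> nat \<Rightarrow> schlumprecht" and \<sigma> and m :: nat and L L' and s :: nat
  where "\<forall>i. normalized (x i) \<and> weakly_null (x i)" "\<sigma> permutes {..<m}"
    "has_iterated_lim [0..<m] (\<lambda>n. norm (\<Sum>i<m. x i (n i))) (\<lambda>_. 0) L"
    "has_iterated_lim (map \<sigma> [0..<m]) (\<lambda>n. norm (\<Sum>i<m. x i (n i))) (\<lambda>_. 0) L'"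
    "real r * real s / 4 \<le> schl_f r * L" "0 \<le> L'" "L' \<le> 24 * real s" "0 < s"
proof -
  define \<epsilon> where "\<epsilon> = 1 / (4 * real r)"
  have \<epsilon>: "0 < \<epsilon>" "\<epsilon> \<le> 1" using r by (auto simp: \<epsilon>_def field_simps)
  have r0: "0 < real r" using r by simp
  define s where "s = r ^ (4 * r)"
  have "2 ^ 1 \<le> r ^ (4 * r)" using r by (intro order_trans[OF power_increasing[of 1 "4 * r" 2] power_mono]) auto
  then have s2: "2 \<le> s" by (simp add: s_def)
  define m where "m = r * s"
  have K1: "real r \<le> schl_f (2 ^ r)"
  proof -
    have "real r = log 2 (2 ^ r)" by simp
    also have "\<dots> \<le> log 2 (real (2 ^ r) + 1)" by (subst log_le_cancel_iff) (auto intro: add_pos_pos)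
    finally show ?thesis by (simp add: schl_f_def)
  qed
  have K2: "real (2 ^ r) powr (2 * \<epsilon>) \<le> schl_f 2"
  proof -
    have "real (2 ^ r) powr (2 * \<epsilon>) = 2 powr (real r * (2 * \<epsilon>))"
      by (simp add: powr_powr[symmetric] powr_realpow)
    also have "real r * (2 * \<epsilon>) = 1 / 2" using r by (simp add: \<epsilon>_def)
    also have "2 powr (1 / 2) = sqrt (2 :: real)" by (simp add: powr_half_sqrt)
    also have "\<dots> \<le> 3 / 2" by (rule real_le_lsqrt) (auto simp: power2_eq_square)
    also have "3 / 2 \<le> log 2 3"
    proof -
      have "3 = log 2 (2 ^ 3 :: real)" by (subst log_nat_power) auto
      also have "\<dots> \<le> log 2 (3 ^ 2)" by (subst log_le_cancel_iff) auto
      also have "\<dots> = 2 * log 2 3" by (subst log_nat_power) auto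
      finally show ?thesis by simp
    qed
    finally show ?thesis by (simp add: schl_f_def)
  qed
  have "\<forall>N. \<exists>\<delta> n N'. 1 \<le> N \<longrightarrow> 0 < \<delta> \<and> \<delta> \<le> \<epsilon> \<and> real N powr \<delta> \<le> 2 \<and> 1 \<le> n \<and> N \<le> N' \<and>
    real r * real n \<le> schl_f N' \<and>
    (\<forall>p\<le>n. flat_norm p \<le> 4 * (real p / real n) powr (1 - \<delta>) * flat_norm n) \<and>
    real s / 4 * flat_norm n \<le> flat_norm (s * n)"
    using exists_block_length[OF s2 \<epsilon>(1)] by blast
  then obtain ex len nx where step: "\<And>N. 1 \<le> N \<Longrightarrow> 0 < ex N \<and> ex N \<le> \<epsilon> \<and> real N powr ex N \<le> 2 \<and>
    1 \<le> len N \<and> N \<le> nx N \<and> real r * real (len N) \<le> schl_f (nx N) \<and>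
    (\<forall>p\<le>len N. flat_norm p \<le> 4 * (real p / real (len N)) powr (1 - ex N) * flat_norm (len N)) \<and>
    real s / 4 * flat_norm (len N) \<le> flat_norm (s * len N)"
    by metis
  define thr where "thr i = (nx ^^ i) (2 ^ r)" for i
  have thr0: "thr 0 = 2 ^ r" and thrS: "thr (Suc i) = nx (thr i)" for i by (simp_all add: thr_def)
  have thr1: "1 \<le> thr i" for i
  proof (induction i)
    case (Suc i)
    then show ?case using step[OF Suc] by (simp add: thrS)
  qed (simp add: thr0)
  define n where "n i = len (thr i)" for i
  define e where "e i = ex (thr i)" for i
  note st = step[OF thr1, folded n_def e_def thrS]
  define l where "l i = n (i div s)" for i
  define x where "x i j = of_completion (flat (l i) j)" for i j
  define F where "F p = norm (\<Sum>i<m. flat (l i) (p i))" for p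
  have normF: "norm (\<Sum>i<m. x i (p i)) = F p" for p
    by (simp add: x_def F_def of_completion_sum[symmetric] norm_of_completion)
  define \<sigma> where "\<sigma> a = (if a < r * s then (a mod r) * s + a div r else a)" for a
  have \<sigma>: "\<sigma> permutes {..<m}"
    using transposition_permutes(1)[of r s] unfolding m_def \<sigma>_def .
  have l\<sigma>: "l (\<sigma> a) = n (a mod r)" if "a < m" for a
    using transposition_permutes(2)[of a r s] that by (simp add: l_def \<sigma>_def m_def)
  have limit: "\<exists>p. has_iterated_lim is F (\<lambda>_. 0) (F p) \<and> follows l p {} is"
    if dist: "distinct is" and all: "set is = {..<m}" for "is"
  proof -
    obtain p where p: "\<forall>j. j \<notin> set is \<longrightarrow> p j = 0" "follows l p {} is"
      using exists_follows[OF finite.emptyI dist, of "\<lambda>_. 0" l] by auto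
    have "has_iterated_lim is F (\<lambda>_. 0) (F p)"
      unfolding F_def using dist all p by (intro has_iterated_lim_flat) auto
    then show ?thesis using p by blast
  qed
  obtain p where p: "has_iterated_lim [0..<m] F (\<lambda>_. 0) (F p)" "follows l p {} [0..<m]"
    using limit[of "[0..<m]"] by (auto simp: lessThan_atLeast0)
  have \<sigma>list: "distinct (map \<sigma> [0..<m])" "set (map \<sigma> [0..<m]) = {..<m}"
    using permutes_image[OF \<sigma>] permutes_inj_on[OF \<sigma>] by (auto simp: distinct_map lessThan_atLeast0)
  obtain q where q: "has_iterated_lim (map \<sigma> [0..<m]) F (\<lambda>_. 0) (F q)" "follows l q {} (map \<sigma> [0..<m])"
    using limit[OF \<sigma>list] by blast
  have lower: "real r * real s / 4 \<le> schl_f r * F p"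
  proof -
    let ?B = "\<lambda>a. {p a..<p a + l a}"
    have ord: "ordered_sets (r * s) ?B"
      by (rule ordered_sets_cong[OF follows_ordered[OF p(2), unfolded length_upt diff_zero m_def]])
        (simp add: m_def)
    have "real r * real s / 4 \<le> schl_f r * norm (\<Sum>a<r * s. (1 / flat_norm (n (a div s))) *\<^sub>R ind (?B a))"
      by (rule grouped_norm_ge[OF ord]) (use r s2 st in \<open>auto simp: l_def\<close>)
    then show ?thesis by (simp add: F_def flat_def l_def m_def)
  qed
  have upper: "F q \<le> 24 * real s"
  proof -
    let ?B = "\<lambda>a. {q (\<sigma> a)..<q (\<sigma> a) + l (\<sigma> a)}"
    have ord: "ordered_sets (r * s) ?B"
      by (rule ordered_sets_cong[OF follows_ordered[OF q(2), unfolded length_map length_upt diff_zero m_def]])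
        (simp add: m_def)
    have "(\<Sum>i<m. flat (l i) (q i)) = (\<Sum>a<m. flat (l (\<sigma> a)) (q (\<sigma> a)))"
      using sum.permute[OF \<sigma>, of "\<lambda>i. flat (l i) (q i)"] by (simp add: comp_def)
    also have "\<dots> = (\<Sum>a<r * s. (1 / flat_norm (n (a mod r))) *\<^sub>R ind (?B a))"
      unfolding flat_def m_def[symmetric] using l\<sigma> by (intro sum.cong) auto
    finally have "F q = norm \<dots>" by (simp add: F_def)
    also have "\<dots> \<le> 12 * (real s + (real r * real s) powr (1 - \<epsilon>))"
    proof (rule cyclic_norm_le[where thr = thr and e = e])
      show "card (?B a) = n (a mod r)" if "a < r * s" for a using l\<sigma>[of a] that by (simp add: m_def)
    qed (use r \<epsilon> K1 K2 st ord in \<open>auto simp: thr0 less_imp_le\<close>)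
    also have "(real r * real s) powr (1 - \<epsilon>) \<le> real s"
    proof -
      have "real r = (real r powr (4 * real r)) powr \<epsilon>" using r by (simp add: powr_powr \<epsilon>_def)
      also have "real r powr (4 * real r) = real s" using r powr_realpow[OF r0, of "4 * r"] by (simp add: s_def)
      also have "real s powr \<epsilon> \<le> (real r * real s) powr \<epsilon>"
        using \<epsilon> r mult_right_mono[of 1 "real r" "real s"] by (intro powr_mono2) auto
      finally have "real r * (real r * real s) powr (1 - \<epsilon>)
          \<le> (real r * real s) powr \<epsilon> * (real r * real s) powr (1 - \<epsilon>)"
        by (intro mult_right_mono) auto
      also have "\<dots> = real r * real s" using r s2 by (simp add: powr_add[symmetric])
      finally show ?thesis using r0 by simp
    qed
    finally show ?thesis by simp
  qed
  show thesis
  proof (rule that)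
    show "\<forall>i. normalized (x i) \<and> weakly_null (x i)"
      unfolding x_def l_def using st by (intro allI conjI normalized_flat weakly_null_flat) blast
    show "has_iterated_lim [0..<m] (\<lambda>n. norm (\<Sum>i<m. x i (n i))) (\<lambda>_. 0) (F p)"
      unfolding normF using p(1) .
    show "has_iterated_lim (map \<sigma> [0..<m]) (\<lambda>n. norm (\<Sum>i<m. x i (n i))) (\<lambda>_. 0) (F q)"
      unfolding normF using q(1) .
    show "0 \<le> F q" by (simp add: F_def)
  qed (use \<sigma> lower upper s2 in auto)
qed

theorem theorem3p10:
  shows "\<not> wnas TYPE(schlumprecht)"
proof
  assume "wnas TYPE(schlumprecht)"
  then obtain C :: real where C: "\<forall>(m :: nat) (x :: nat \<Rightarrow> nat \<Rightarrow> schlumprecht) \<sigma> L L'.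
     (\<forall>i<m. normalized (x i) \<and> weakly_null (x i)) \<longrightarrow> \<sigma> permutes {..<m} \<longrightarrow>
     has_iterated_lim [0..<m] (\<lambda>n. norm (\<Sum>i<m. x i (n i))) (\<lambda>_. 0) L \<longrightarrow>
     has_iterated_lim (map \<sigma> [0..<m]) (\<lambda>n. norm (\<Sum>i<m. x i (n i))) (\<lambda>_. 0) L' \<longrightarrow>
     L \<le> C * L'"
    unfolding wnas_def by (elim exE)
  \<comment> \<open>\<open>96 = 4 * 24\<close>, from the constants of the two estimates; a negative \<open>C\<close> is replaced by \<open>0\<close>.\<close>
  define c where "c = max C 0"
  have "filterlim (\<lambda>r. real r / log 2 (real r + 1)) at_top sequentially" by real_asymp
  then have "\<forall>\<^sub>F r in sequentially. 96 * c < real r / log 2 (real r + 1)"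
    by (simp add: filterlim_at_top_dense)
  then have "\<forall>\<^sub>F r in sequentially. 96 * c < real r / schl_f r \<and> 2 \<le> r"
    using eventually_ge_at_top[of 2] by eventually_elim (simp add: schl_f_def)
  then obtain r where r: "96 * c < real r / schl_f r" "2 \<le> r"
    unfolding eventually_sequentially by blast
  obtain x :: "nat \<Rightarrow> nat \<Rightarrow> schlumprecht" and \<sigma> m L L' s where w:
    "\<forall>i. normalized (x i) \<and> weakly_null (x i)" "\<sigma> permutes {..<m}"
    "has_iterated_lim [0..<m] (\<lambda>n. norm (\<Sum>i<m. x i (n i))) (\<lambda>_. 0) L"
    "has_iterated_lim (map \<sigma> [0..<m]) (\<lambda>n. norm (\<Sum>i<m. x i (n i))) (\<lambda>_. 0) L'"
    "real r * real s / 4 \<le> schl_f r * L" "0 \<le> L'" "L' \<le> 24 * real s" "0 < s"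
    by (rule not_wnas_witness[OF r(2)])
  have f: "0 < schl_f r" using schl_f_gt1[OF r(2)] by simp
  have "L \<le> C * L'" by (rule C[rule_format, OF _ w(2-4)]) (simp add: w(1))
  also have "\<dots> \<le> c * (24 * real s)"
    using w(6,7) by (intro mult_mono) (auto simp: c_def)
  finally have "schl_f r * L \<le> schl_f r * (c * (24 * real s))" using f by simp
  then have "real r * real s \<le> (96 * c * schl_f r) * real s"
    using w(5) by (simp add: algebra_simps)
  then have "real r \<le> 96 * c * schl_f r" using w(8) by simp
  then show False using r(1) f by (simp add: pos_less_divide_eq)
qed

end
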